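(* Let $A$ be a ring and let $G$ be a group with $G \neq \{e\}$. (i) Suppose the group ring $A[G]$ is local. Then $A$ is a local ring and, denoting by $M$ its maximal left ideal and by $K = A/M$ its residue division ring, there is a prime number $p$ such that $K$ has characteristic $p$ (in particular the characteristic of $K$ is nonzero) and $G$ is a $p$-group. (ii) Conversely, suppose that $G$ is locally finite, that $A$ is a local ring with maximal left ideal $M$, and that there is a prime number $p$ such that $K = A/M$ has characteristic $p$ and $G$ is a $p$-group. Then $A[G]$ is a local ring.
   Context: Rings are associative with identity $1 \neq 0$, not necessarily commutative; $G$ is an arbitrary (not necessarily commutative or finite) group with identity $e$. $A[G]$ denotes the group ring of $G$ with coefficients in $A$. A ring is local if it has a unique maximal left ideal (equivalently, its quotient by its Jacobson radical is a division ring). For a prime $p$, a $p$-group is a group (possibly infinite) in which every element has finite order equal to a power of $p$. A group is locally finite if each of its finitely generated subgroups is finite. *)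

theory Defs
  imports "HOL-Algebra.Algebra"
begin

section \<open>Local rings\<close>

text \<open>The rings of \<^locale>\<open>ring\<close> need not be commutative.\<close>

locale left_ideal = additive_subgroup I R + ring R for I and R (structure) +
  assumes I_l_closed: "\<lbrakk>a \<in> I; x \<in> carrier R\<rbrakk> \<Longrightarrow> x \<otimes> a \<in> I"

locale maximal_left_ideal = left_ideal +
  assumes I_notcarr: "carrier R \<noteq> I"
    and I_maximal: "\<lbrakk>left_ideal J R; I \<subseteq> J; J \<subseteq> carrier R\<rbrakk> \<Longrightarrow> J = I \<or> J = carrier R"

locale local_ring = ring +
  assumes unique_maximal_left_ideal: "\<exists>!M. maximal_left_ideal M R"

text \<open>In a local ring the maximal left ideal \<open>M\<close> is the Jacobson radical, hence two-sided, so that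
  the library's \<^term>\<open>R Quot M\<close> is the residue ring.\<close>

definition ring_char :: "('a, 'm) ring_scheme \<Rightarrow> nat" where
  "ring_char R =
    (if \<exists>n::nat. n > 0 \<and> add_pow R n \<one>\<^bsub>R\<^esub> = \<zero>\<^bsub>R\<^esub>
     then LEAST n::nat. n > 0 \<and> add_pow R n \<one>\<^bsub>R\<^esub> = \<zero>\<^bsub>R\<^esub> else 0)"


section \<open>Groups\<close>

text \<open>\<^const>\<open>group.ord\<close> is \<open>0\<close> on elements of infinite order, so for a prime \<open>p\<close> the
  condition below forces every element to have finite order.\<close>

definition p_group :: "nat \<Rightarrow> ('g, 'n) monoid_scheme \<Rightarrow> bool" where
  "p_group p G \<longleftrightarrow> group G \<and> (\<forall>x \<in> carrier G. \<exists>k. group.ord G x = p ^ k)"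

definition locally_finite_group :: "('g, 'n) monoid_scheme \<Rightarrow> bool" where
  "locally_finite_group G \<longleftrightarrow>
    group G \<and> (\<forall>S. S \<subseteq> carrier G \<longrightarrow> finite S \<longrightarrow> finite (generate G S))"


section \<open>Group rings\<close>

definition supp :: "('a, 'm) ring_scheme \<Rightarrow> ('g, 'n) monoid_scheme \<Rightarrow> ('g \<Rightarrow> 'a) \<Rightarrow> 'g set" where
  "supp A G f = {x \<in> carrier G. f x \<noteq> \<zero>\<^bsub>A\<^esub>}"

text \<open>A finitely supported function \<open>f\<close> stands for the formal sum of the terms \<open>f x \<cdot> x\<close>.
  It is \<^const>\<open>undefined\<close> outside of \<^term>\<open>carrier G\<close>, so that equality of formal sums is
  equality in HOL.\<close>

definition group_ring :: "('a, 'm) ring_scheme \<Rightarrow> ('g, 'n) monoid_scheme \<Rightarrow> ('g \<Rightarrow> 'a) ring" where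
  "group_ring A G =
    \<lparr>carrier = {f \<in> carrier G \<rightarrow>\<^sub>E carrier A. finite (supp A G f)},
     monoid.mult = (\<lambda>f g. \<lambda>x \<in> carrier G.
       \<Oplus>\<^bsub>A\<^esub>y \<in> supp A G f. f y \<otimes>\<^bsub>A\<^esub> g (inv\<^bsub>G\<^esub> y \<otimes>\<^bsub>G\<^esub> x)),
     monoid.one = (\<lambda>x \<in> carrier G. if x = \<one>\<^bsub>G\<^esub> then \<one>\<^bsub>A\<^esub> else \<zero>\<^bsub>A\<^esub>),
     ring.zero = (\<lambda>x \<in> carrier G. \<zero>\<^bsub>A\<^esub>),
     ring.add = (\<lambda>f g. \<lambda>x \<in> carrier G. f x \<oplus>\<^bsub>A\<^esub> g x)\<rparr>"


lemma (in abelian_monoid) finsum_swap: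
  assumes "finite S" "finite T" "\<And>x y. x \<in> S \<Longrightarrow> y \<in> T \<Longrightarrow> f x y \<in> carrier G"
  shows "(\<Oplus>x\<in>S. \<Oplus>y\<in>T. f x y) = (\<Oplus>y\<in>T. \<Oplus>x\<in>S. f x y)"
  using assms(1,3)
proof (induction S)
  case (insert a S)
  have "(\<Oplus>x\<in>insert a S. \<Oplus>y\<in>T. f x y) = (\<Oplus>y\<in>T. f a y) \<oplus> (\<Oplus>y\<in>T. \<Oplus>x\<in>S. f x y)"
    using insert by (subst finsum_insert) (auto intro!: finsum_closed)
  also have "\<dots> = (\<Oplus>y\<in>T. f a y \<oplus> (\<Oplus>x\<in>S. f x y))"
    using insert by (subst finsum_addf) (auto intro!: finsum_closed)
  also have "\<dots> = (\<Oplus>y\<in>T. \<Oplus>x\<in>insert a S. f x y)"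
    using insert by (intro finsum_cong') (auto intro!: finsum_closed)
  finally show ?case .
qed simp

lemma group_ring_is_ring:
  fixes A :: "('a, 'm) ring_scheme" and G :: "('g, 'n) monoid_scheme"
  assumes "ring A" "group G"
  shows "ring (group_ring A G)"
proof -
  interpret A: ring A by fact
  interpret G: group G by fact
  let ?C = "{f \<in> carrier G \<rightarrow>\<^sub>E carrier A. finite (supp A G f)}"
  let ?m = "\<lambda>f g. \<lambda>x \<in> carrier G.
    \<Oplus>\<^bsub>A\<^esub>y \<in> supp A G f. f y \<otimes>\<^bsub>A\<^esub> g (inv\<^bsub>G\<^esub> y \<otimes>\<^bsub>G\<^esub> x)"
  let ?u = "\<lambda>x \<in> carrier G. if x = \<one>\<^bsub>G\<^esub> then \<one>\<^bsub>A\<^esub> else \<zero>\<^bsub>A\<^esub>"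
  let ?a = "\<lambda>f g. \<lambda>x \<in> carrier G. f x \<oplus>\<^bsub>A\<^esub> g x"
  have sub: "supp A G f \<subseteq> carrier G" for f by (auto simp: supp_def)
  have cl: "f x \<in> carrier A" if "f \<in> ?C" "x \<in> carrier G" for f x using that by auto
  have fin: "finite (supp A G f)" if "f \<in> ?C" for f using that by auto
  have nz: "f x = \<zero>\<^bsub>A\<^esub>" if "x \<in> carrier G" "x \<notin> supp A G f" for f x
    using that by (auto simp: supp_def)
  have mult_ext: "?m f g x = (\<Oplus>\<^bsub>A\<^esub>y \<in> S. f y \<otimes>\<^bsub>A\<^esub> g (inv\<^bsub>G\<^esub> y \<otimes>\<^bsub>G\<^esub> x))"
    if "f \<in> ?C" "g \<in> ?C" "x \<in> carrier G" "finite S" "supp A G f \<subseteq> S" "S \<subseteq> carrier G" for f g S x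
  proof -
    have c: "y \<in> S \<Longrightarrow> f y \<in> carrier A \<and> g (inv\<^bsub>G\<^esub> y \<otimes>\<^bsub>G\<^esub> x) \<in> carrier A" for y
      using cl[OF that(1)] cl[OF that(2)] that(3,6) by auto
    have "(\<Oplus>\<^bsub>A\<^esub>y \<in> supp A G f. f y \<otimes>\<^bsub>A\<^esub> g (inv\<^bsub>G\<^esub> y \<otimes>\<^bsub>G\<^esub> x))
       = (\<Oplus>\<^bsub>A\<^esub>y \<in> S. f y \<otimes>\<^bsub>A\<^esub> g (inv\<^bsub>G\<^esub> y \<otimes>\<^bsub>G\<^esub> x))"
    proof (rule A.add.finprod_mono_neutral_cong_left)
      show "\<And>i. i \<in> S - supp A G f \<Longrightarrow> f i \<otimes>\<^bsub>A\<^esub> g (inv\<^bsub>G\<^esub> i \<otimes>\<^bsub>G\<^esub> x) = \<zero>\<^bsub>A\<^esub>"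
        using c nz that by (metis A.l_null DiffE subsetD)
    qed (use that c in auto)
    then show ?thesis using that by simp
  qed
  have mC: "?m f g \<in> ?C" if f: "f \<in> ?C" and g: "g \<in> ?C" for f g
  proof -
    note that = f g
    have "?m f g \<in> carrier G \<rightarrow>\<^sub>E carrier A"
    proof (rule restrict_PiE_iff[THEN iffD2], rule ballI)
      fix x assume x: "x \<in> carrier G"
      show "(\<Oplus>\<^bsub>A\<^esub>y \<in> supp A G f. f y \<otimes>\<^bsub>A\<^esub> g (inv\<^bsub>G\<^esub> y \<otimes>\<^bsub>G\<^esub> x)) \<in> carrier A"
        using sub[of f] x that by (intro A.finsum_closed funcsetI A.m_closed cl) auto
    qed
    moreover have "supp A G (?m f g) \<subseteq> (\<lambda>(y, z). y \<otimes>\<^bsub>G\<^esub> z) ` (supp A G f \<times> supp A G g)"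
    proof
      fix x assume x: "x \<in> supp A G (?m f g)"
      then have xG: "x \<in> carrier G" using sub by auto
      show "x \<in> (\<lambda>(y, z). y \<otimes>\<^bsub>G\<^esub> z) ` (supp A G f \<times> supp A G g)"
      proof (rule ccontr)
        assume n: "\<not> ?thesis"
        have "f y \<otimes>\<^bsub>A\<^esub> g (inv\<^bsub>G\<^esub> y \<otimes>\<^bsub>G\<^esub> x) = \<zero>\<^bsub>A\<^esub>" if y: "y \<in> supp A G f" for y
        proof -
          have yG: "y \<in> carrier G" using sub y by auto
          have "inv\<^bsub>G\<^esub> y \<otimes>\<^bsub>G\<^esub> x \<notin> supp A G g"
          proof
            assume "inv\<^bsub>G\<^esub> y \<otimes>\<^bsub>G\<^esub> x \<in> supp A G g"
            moreover have "x = y \<otimes>\<^bsub>G\<^esub> (inv\<^bsub>G\<^esub> y \<otimes>\<^bsub>G\<^esub> x)" using yG xG by (simp add: G.m_assoc[symmetric])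
            ultimately show False using n y by (metis (mono_tags, lifting) SigmaI case_prod_conv image_eqI)
          qed
          then show ?thesis using nz[of "inv\<^bsub>G\<^esub> y \<otimes>\<^bsub>G\<^esub> x" g] yG xG cl[OF f yG] by simp
        qed
        then have "(\<Oplus>\<^bsub>A\<^esub>y \<in> supp A G f. f y \<otimes>\<^bsub>A\<^esub> g (inv\<^bsub>G\<^esub> y \<otimes>\<^bsub>G\<^esub> x)) = \<zero>\<^bsub>A\<^esub>"
          by (rule A.add.finprod_one_eqI)
        then show False using x xG by (simp add: supp_def)
      qed
    qed
    moreover have "finite ((\<lambda>(y, z). y \<otimes>\<^bsub>G\<^esub> z) ` (supp A G f \<times> supp A G g))"
      using that by auto
    ultimately show ?thesis using finite_subset by blast
  qed
  have aC: "?a f g \<in> ?C" if "f \<in> ?C" "g \<in> ?C" for f g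
  proof -
    have "supp A G (?a f g) \<subseteq> supp A G f \<union> supp A G g" by (auto simp: supp_def)
    then have "finite (supp A G (?a f g))" using that finite_subset by fastforce
    then show ?thesis using that by (auto simp: PiE_iff)
  qed
  have uC: "?u \<in> ?C"
  proof -
    have "supp A G ?u \<subseteq> {\<one>\<^bsub>G\<^esub>}" by (auto simp: supp_def)
    then show ?thesis using finite_subset by fastforce
  qed
  have zC: "(\<lambda>x\<in>carrier G. \<zero>\<^bsub>A\<^esub>) \<in> ?C" by (auto simp: supp_def)
  have ext: "f = g" if "f \<in> ?C" "g \<in> ?C" "\<And>x. x \<in> carrier G \<Longrightarrow> f x = g x" for f g
    using that by (auto intro: PiE_ext)
  have assoc: "?m (?m f g) h = ?m f (?m g h)" if f: "f \<in> ?C" and g: "g \<in> ?C" and h: "h \<in> ?C" for f g h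
  proof (rule ext)
    show "?m (?m f g) h \<in> ?C" "?m f (?m g h) \<in> ?C"
      by (rule mC[OF mC[OF f g] h], rule mC[OF f mC[OF g h]])
    fix x assume x: "x \<in> carrier G"
    let ?S = "supp A G f" and ?T = "supp A G g"
    define P where "P = (\<lambda>(y, z). y \<otimes>\<^bsub>G\<^esub> z) ` (?S \<times> ?T) \<union> supp A G (?m f g)"
    have P: "finite P" "P \<subseteq> carrier G" "supp A G (?m f g) \<subseteq> P"
      using fin[OF f] fin[OF g] fin[OF mC[OF f g]] sub[of f] sub[of g] sub[of "?m f g"]
      unfolding P_def by auto
    note cls = cl[OF f] cl[OF g] cl[OF h]
    have S: "y \<in> carrier G" if "y \<in> ?S" for y using sub that by auto
    have PG: "y \<in> carrier G" if "y \<in> P" for y using P that by auto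
    have inner: "(\<Oplus>\<^bsub>A\<^esub>y \<in> P. g (inv\<^bsub>G\<^esub> z \<otimes>\<^bsub>G\<^esub> y) \<otimes>\<^bsub>A\<^esub> h (inv\<^bsub>G\<^esub> y \<otimes>\<^bsub>G\<^esub> x)) = ?m g h (inv\<^bsub>G\<^esub> z \<otimes>\<^bsub>G\<^esub> x)"
      if z: "z \<in> ?S" for z
    proof -
      let ?l = "\<lambda>y. inv\<^bsub>G\<^esub> z \<otimes>\<^bsub>G\<^esub> y"
      have zG: "z \<in> carrier G" using S z .
      have inj: "inj_on ?l P" using PG zG by (intro inj_onI) simp
      have "?T \<subseteq> ?l ` P"
      proof
        fix t assume t: "t \<in> ?T"
        then have tG: "t \<in> carrier G" using sub by auto
        have "z \<otimes>\<^bsub>G\<^esub> t \<in> P" using z t unfolding P_def by auto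
        moreover have "t = ?l (z \<otimes>\<^bsub>G\<^esub> t)" using zG tG by (simp add: G.m_assoc[symmetric])
        ultimately show "t \<in> ?l ` P" by blast
      qed
      then have "?m g h (inv\<^bsub>G\<^esub> z \<otimes>\<^bsub>G\<^esub> x)
        = (\<Oplus>\<^bsub>A\<^esub>w \<in> ?l ` P. g w \<otimes>\<^bsub>A\<^esub> h (inv\<^bsub>G\<^esub> w \<otimes>\<^bsub>G\<^esub> (inv\<^bsub>G\<^esub> z \<otimes>\<^bsub>G\<^esub> x)))"
        using P PG zG x g h by (intro mult_ext) auto
      also have "\<dots> = (\<Oplus>\<^bsub>A\<^esub>y \<in> P. g (?l y) \<otimes>\<^bsub>A\<^esub> h (inv\<^bsub>G\<^esub> (?l y) \<otimes>\<^bsub>G\<^esub> (inv\<^bsub>G\<^esub> z \<otimes>\<^bsub>G\<^esub> x)))"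
        using PG zG x inj by (intro A.add.finprod_reindex) (auto intro!: A.m_closed cls)
      also have "\<dots> = (\<Oplus>\<^bsub>A\<^esub>y \<in> P. g (?l y) \<otimes>\<^bsub>A\<^esub> h (inv\<^bsub>G\<^esub> y \<otimes>\<^bsub>G\<^esub> x))"
      proof (rule A.finsum_cong')
        fix y assume "y \<in> P"
        then have yG: "y \<in> carrier G" by (rule PG)
        have "inv\<^bsub>G\<^esub> (?l y) \<otimes>\<^bsub>G\<^esub> (inv\<^bsub>G\<^esub> z \<otimes>\<^bsub>G\<^esub> x) = inv\<^bsub>G\<^esub> y \<otimes>\<^bsub>G\<^esub> (z \<otimes>\<^bsub>G\<^esub> (inv\<^bsub>G\<^esub> z \<otimes>\<^bsub>G\<^esub> x))"
          using yG zG x by (simp add: G.inv_mult_group G.m_assoc)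
        also have "\<dots> = inv\<^bsub>G\<^esub> y \<otimes>\<^bsub>G\<^esub> x" using yG zG x by (simp add: G.m_assoc[symmetric])
        finally show "g (?l y) \<otimes>\<^bsub>A\<^esub> h (inv\<^bsub>G\<^esub> (?l y) \<otimes>\<^bsub>G\<^esub> (inv\<^bsub>G\<^esub> z \<otimes>\<^bsub>G\<^esub> x))
          = g (?l y) \<otimes>\<^bsub>A\<^esub> h (inv\<^bsub>G\<^esub> y \<otimes>\<^bsub>G\<^esub> x)" by simp
      qed (use PG zG x in \<open>auto intro!: A.m_closed cls\<close>)
      finally show ?thesis by simp
    qed
    have "?m (?m f g) h x = (\<Oplus>\<^bsub>A\<^esub>y \<in> P. ?m f g y \<otimes>\<^bsub>A\<^esub> h (inv\<^bsub>G\<^esub> y \<otimes>\<^bsub>G\<^esub> x))"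
      by (rule mult_ext[OF mC[OF f g] h x P(1,3,2)])
    also have "\<dots> = (\<Oplus>\<^bsub>A\<^esub>y \<in> P. \<Oplus>\<^bsub>A\<^esub>z \<in> ?S. f z \<otimes>\<^bsub>A\<^esub> (g (inv\<^bsub>G\<^esub> z \<otimes>\<^bsub>G\<^esub> y) \<otimes>\<^bsub>A\<^esub> h (inv\<^bsub>G\<^esub> y \<otimes>\<^bsub>G\<^esub> x)))"
    proof (rule A.finsum_cong')
      fix y assume "y \<in> P"
      then have y: "y \<in> carrier G" by (rule PG)
      have "?m f g y \<otimes>\<^bsub>A\<^esub> h (inv\<^bsub>G\<^esub> y \<otimes>\<^bsub>G\<^esub> x)
        = (\<Oplus>\<^bsub>A\<^esub>z \<in> ?S. (f z \<otimes>\<^bsub>A\<^esub> g (inv\<^bsub>G\<^esub> z \<otimes>\<^bsub>G\<^esub> y)) \<otimes>\<^bsub>A\<^esub> h (inv\<^bsub>G\<^esub> y \<otimes>\<^bsub>G\<^esub> x))"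
        using y x S fin[OF f] by (simp, intro A.finsum_ldistr) (auto intro!: A.m_closed cls)
      also have "\<dots> = (\<Oplus>\<^bsub>A\<^esub>z \<in> ?S. f z \<otimes>\<^bsub>A\<^esub> (g (inv\<^bsub>G\<^esub> z \<otimes>\<^bsub>G\<^esub> y) \<otimes>\<^bsub>A\<^esub> h (inv\<^bsub>G\<^esub> y \<otimes>\<^bsub>G\<^esub> x)))"
        using y x S by (intro A.finsum_cong') (auto intro!: A.m_closed A.m_assoc cls)
      finally show "?m f g y \<otimes>\<^bsub>A\<^esub> h (inv\<^bsub>G\<^esub> y \<otimes>\<^bsub>G\<^esub> x) = \<dots>" .
    qed (use PG S x in \<open>auto intro!: A.finsum_closed A.m_closed cls\<close>)
    also have "\<dots> = (\<Oplus>\<^bsub>A\<^esub>z \<in> ?S. \<Oplus>\<^bsub>A\<^esub>y \<in> P. f z \<otimes>\<^bsub>A\<^esub> (g (inv\<^bsub>G\<^esub> z \<otimes>\<^bsub>G\<^esub> y) \<otimes>\<^bsub>A\<^esub> h (inv\<^bsub>G\<^esub> y \<otimes>\<^bsub>G\<^esub> x)))"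
      using P fin[OF f] PG S x by (intro A.finsum_swap) (auto intro!: A.m_closed cls)
    also have "\<dots> = (\<Oplus>\<^bsub>A\<^esub>z \<in> ?S. f z \<otimes>\<^bsub>A\<^esub> ?m g h (inv\<^bsub>G\<^esub> z \<otimes>\<^bsub>G\<^esub> x))"
    proof (rule A.finsum_cong')
      fix z assume z: "z \<in> ?S"
      have "(\<Oplus>\<^bsub>A\<^esub>y \<in> P. f z \<otimes>\<^bsub>A\<^esub> (g (inv\<^bsub>G\<^esub> z \<otimes>\<^bsub>G\<^esub> y) \<otimes>\<^bsub>A\<^esub> h (inv\<^bsub>G\<^esub> y \<otimes>\<^bsub>G\<^esub> x)))
        = f z \<otimes>\<^bsub>A\<^esub> (\<Oplus>\<^bsub>A\<^esub>y \<in> P. g (inv\<^bsub>G\<^esub> z \<otimes>\<^bsub>G\<^esub> y) \<otimes>\<^bsub>A\<^esub> h (inv\<^bsub>G\<^esub> y \<otimes>\<^bsub>G\<^esub> x))"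
        using P PG S[OF z] x by (intro A.finsum_rdistr[symmetric]) (auto intro!: A.m_closed cls)
      then show "(\<Oplus>\<^bsub>A\<^esub>y \<in> P. f z \<otimes>\<^bsub>A\<^esub> (g (inv\<^bsub>G\<^esub> z \<otimes>\<^bsub>G\<^esub> y) \<otimes>\<^bsub>A\<^esub> h (inv\<^bsub>G\<^esub> y \<otimes>\<^bsub>G\<^esub> x)))
        = f z \<otimes>\<^bsub>A\<^esub> ?m g h (inv\<^bsub>G\<^esub> z \<otimes>\<^bsub>G\<^esub> x)" by (simp only: inner[OF z])
    next
      show "(\<lambda>z. f z \<otimes>\<^bsub>A\<^esub> ?m g h (inv\<^bsub>G\<^esub> z \<otimes>\<^bsub>G\<^esub> x)) \<in> ?S \<rightarrow> carrier A"
        by (rule funcsetI, rule A.m_closed, rule cls(1), erule S, rule cl[OF mC[OF g h]],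
          rule G.m_closed, rule G.inv_closed, erule S, rule x)
    qed simp
    also have "\<dots> = ?m f (?m g h) x" using x by simp
    finally show "?m (?m f g) h x = ?m f (?m g h) x" .
  qed
  have lone: "?m ?u f = f" if f: "f \<in> ?C" for f
  proof (rule ext)
    show "?m ?u f \<in> ?C" "f \<in> ?C" by (rule mC[OF uC f], rule f)
    fix x assume x: "x \<in> carrier G"
    have "?m ?u f x = (\<Oplus>\<^bsub>A\<^esub>y \<in> {\<one>\<^bsub>G\<^esub>}. ?u y \<otimes>\<^bsub>A\<^esub> f (inv\<^bsub>G\<^esub> y \<otimes>\<^bsub>G\<^esub> x))"
      using uC f x by (intro mult_ext) (auto simp: supp_def)
    then show "?m ?u f x = f x" using x cl[OF f] by simp
  qed
  have rone: "?m f ?u = f" if f: "f \<in> ?C" for f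
  proof (rule ext)
    show "?m f ?u \<in> ?C" "f \<in> ?C" by (rule mC[OF f uC], rule f)
    fix x assume x: "x \<in> carrier G"
    let ?S = "insert x (supp A G f)"
    have S: "y \<in> carrier G" if "y \<in> ?S" for y using sub x that by auto
    have "?m f ?u x = (\<Oplus>\<^bsub>A\<^esub>y \<in> ?S. f y \<otimes>\<^bsub>A\<^esub> ?u (inv\<^bsub>G\<^esub> y \<otimes>\<^bsub>G\<^esub> x))"
      by (rule mult_ext[OF f uC x]) (use fin[OF f] sub x in auto)
    also have "\<dots> = (\<Oplus>\<^bsub>A\<^esub>y \<in> ?S. if x = y then f y else \<zero>\<^bsub>A\<^esub>)"
    proof (rule A.finsum_cong')
      fix y assume "y \<in> ?S"
      then have y: "y \<in> carrier G" by (rule S)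
      have "inv\<^bsub>G\<^esub> y \<otimes>\<^bsub>G\<^esub> x = \<one>\<^bsub>G\<^esub> \<longleftrightarrow> x = y"
        using x y by (metis G.inv_solve_left' G.l_inv G.one_closed G.r_one)
      then show "f y \<otimes>\<^bsub>A\<^esub> ?u (inv\<^bsub>G\<^esub> y \<otimes>\<^bsub>G\<^esub> x) = (if x = y then f y else \<zero>\<^bsub>A\<^esub>)"
        using x y cl[OF f] by simp
    qed (use S cl[OF f] in auto)
    also have "\<dots> = f x"
      using fin[OF f] S cl[OF f] by (intro A.add.finprod_singleton) auto
    finally show "?m f ?u x = f x" .
  qed
  have ldist: "?m (?a f g) h = ?a (?m f h) (?m g h)" if f: "f \<in> ?C" and g: "g \<in> ?C" and h: "h \<in> ?C" for f g h
  proof (rule ext)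
    show "?m (?a f g) h \<in> ?C" "?a (?m f h) (?m g h) \<in> ?C"
      by (rule mC[OF aC[OF f g] h], rule aC[OF mC[OF f h] mC[OF g h]])
    fix x assume x: "x \<in> carrier G"
    let ?S = "supp A G f \<union> supp A G g"
    have S: "y \<in> carrier G" if "y \<in> ?S" for y using sub that by auto
    note cls = cl[OF f] cl[OF g] cl[OF h]
    have "?m (?a f g) h x = (\<Oplus>\<^bsub>A\<^esub>y \<in> ?S. ?a f g y \<otimes>\<^bsub>A\<^esub> h (inv\<^bsub>G\<^esub> y \<otimes>\<^bsub>G\<^esub> x))"
      by (rule mult_ext[OF aC[OF f g] h x]) (use fin[OF f] fin[OF g] in \<open>auto simp: supp_def\<close>)
    also have "\<dots> = (\<Oplus>\<^bsub>A\<^esub>y \<in> ?S. f y \<otimes>\<^bsub>A\<^esub> h (inv\<^bsub>G\<^esub> y \<otimes>\<^bsub>G\<^esub> x) \<oplus>\<^bsub>A\<^esub> g y \<otimes>\<^bsub>A\<^esub> h (inv\<^bsub>G\<^esub> y \<otimes>\<^bsub>G\<^esub> x))"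
      using S x by (intro A.finsum_cong') (auto intro!: A.m_closed A.a_closed A.l_distr cls)
    also have "\<dots> = (\<Oplus>\<^bsub>A\<^esub>y \<in> ?S. f y \<otimes>\<^bsub>A\<^esub> h (inv\<^bsub>G\<^esub> y \<otimes>\<^bsub>G\<^esub> x)) \<oplus>\<^bsub>A\<^esub> (\<Oplus>\<^bsub>A\<^esub>y \<in> ?S. g y \<otimes>\<^bsub>A\<^esub> h (inv\<^bsub>G\<^esub> y \<otimes>\<^bsub>G\<^esub> x))"
      using S x by (intro A.finsum_addf) (auto intro!: A.m_closed cls)
    also have "(\<Oplus>\<^bsub>A\<^esub>y \<in> ?S. f y \<otimes>\<^bsub>A\<^esub> h (inv\<^bsub>G\<^esub> y \<otimes>\<^bsub>G\<^esub> x)) = ?m f h x"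
      by (rule mult_ext[OF f h x, symmetric]) (use fin[OF f] fin[OF g] in \<open>auto simp: supp_def\<close>)
    also have "(\<Oplus>\<^bsub>A\<^esub>y \<in> ?S. g y \<otimes>\<^bsub>A\<^esub> h (inv\<^bsub>G\<^esub> y \<otimes>\<^bsub>G\<^esub> x)) = ?m g h x"
      by (rule mult_ext[OF g h x, symmetric]) (use fin[OF f] fin[OF g] in \<open>auto simp: supp_def\<close>)
    also have "?m f h x \<oplus>\<^bsub>A\<^esub> ?m g h x = ?a (?m f h) (?m g h) x" by (simp only: restrict_apply'[OF x])
    finally show "?m (?a f g) h x = ?a (?m f h) (?m g h) x" .
  qed
  have rdist: "?m h (?a f g) = ?a (?m h f) (?m h g)" if f: "f \<in> ?C" and g: "g \<in> ?C" and h: "h \<in> ?C" for f g h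
  proof (rule ext)
    show "?m h (?a f g) \<in> ?C" "?a (?m h f) (?m h g) \<in> ?C"
      by (rule mC[OF h aC[OF f g]], rule aC[OF mC[OF h f] mC[OF h g]])
    fix x assume x: "x \<in> carrier G"
    let ?S = "supp A G h"
    have S: "y \<in> carrier G" if "y \<in> ?S" for y using sub that by auto
    note cls = cl[OF f] cl[OF g] cl[OF h]
    have "(\<Oplus>\<^bsub>A\<^esub>y \<in> ?S. h y \<otimes>\<^bsub>A\<^esub> ?a f g (inv\<^bsub>G\<^esub> y \<otimes>\<^bsub>G\<^esub> x))
      = (\<Oplus>\<^bsub>A\<^esub>y \<in> ?S. h y \<otimes>\<^bsub>A\<^esub> f (inv\<^bsub>G\<^esub> y \<otimes>\<^bsub>G\<^esub> x) \<oplus>\<^bsub>A\<^esub> h y \<otimes>\<^bsub>A\<^esub> g (inv\<^bsub>G\<^esub> y \<otimes>\<^bsub>G\<^esub> x))"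
      using S x by (intro A.finsum_cong') (auto intro!: A.m_closed A.a_closed A.r_distr cls)
    also have "\<dots> = (\<Oplus>\<^bsub>A\<^esub>y \<in> ?S. h y \<otimes>\<^bsub>A\<^esub> f (inv\<^bsub>G\<^esub> y \<otimes>\<^bsub>G\<^esub> x)) \<oplus>\<^bsub>A\<^esub> (\<Oplus>\<^bsub>A\<^esub>y \<in> ?S. h y \<otimes>\<^bsub>A\<^esub> g (inv\<^bsub>G\<^esub> y \<otimes>\<^bsub>G\<^esub> x))"
      using S x by (intro A.finsum_addf) (auto intro!: A.m_closed cls)
    finally show "?m h (?a f g) x = ?a (?m h f) (?m h g) x" by (simp only: restrict_apply'[OF x])
  qed
  have inv: "\<exists>g\<in>?C. ?a g f = (\<lambda>x\<in>carrier G. \<zero>\<^bsub>A\<^esub>)" if f: "f \<in> ?C" for f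
  proof -
    let ?g = "\<lambda>x\<in>carrier G. \<ominus>\<^bsub>A\<^esub> f x"
    have "supp A G ?g \<subseteq> supp A G f" by (auto simp: supp_def)
    then have "?g \<in> ?C" using fin[OF f] cl[OF f] finite_subset by fastforce
    moreover have "?a ?g f = (\<lambda>x\<in>carrier G. \<zero>\<^bsub>A\<^esub>)"
      using cl[OF f] by (auto simp: A.l_neg intro!: restrict_ext)
    ultimately show ?thesis by blast
  qed
  show ?thesis
  proof (rule ringI)
    show "abelian_group (group_ring A G)"
    proof (rule abelian_groupI)
      fix f g h
      assume "f \<in> carrier (group_ring A G)" "g \<in> carrier (group_ring A G)" "h \<in> carrier (group_ring A G)"
      then have C: "f \<in> ?C" "g \<in> ?C" "h \<in> ?C" by (simp_all add: group_ring_def)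
      note cls = cl[OF C(1)] cl[OF C(2)] cl[OF C(3)]
      show "f \<oplus>\<^bsub>group_ring A G\<^esub> g \<oplus>\<^bsub>group_ring A G\<^esub> h = f \<oplus>\<^bsub>group_ring A G\<^esub> (g \<oplus>\<^bsub>group_ring A G\<^esub> h)"
        using cls by (auto simp: group_ring_def A.a_assoc intro!: restrict_ext)
    next
      fix f g assume "f \<in> carrier (group_ring A G)" "g \<in> carrier (group_ring A G)"
      then have C: "f \<in> ?C" "g \<in> ?C" by (simp_all add: group_ring_def)
      show "f \<oplus>\<^bsub>group_ring A G\<^esub> g \<in> carrier (group_ring A G)"
        using aC[OF C] by (simp add: group_ring_def)
      show "f \<oplus>\<^bsub>group_ring A G\<^esub> g = g \<oplus>\<^bsub>group_ring A G\<^esub> f"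
        using cl[OF C(1)] cl[OF C(2)] by (auto simp: group_ring_def A.a_comm intro!: restrict_ext)
    next
      fix f assume "f \<in> carrier (group_ring A G)"
      then have C: "f \<in> ?C" by (simp add: group_ring_def)
      show "\<zero>\<^bsub>group_ring A G\<^esub> \<oplus>\<^bsub>group_ring A G\<^esub> f = f"
        using C by (auto simp: group_ring_def PiE_iff fun_eq_iff extensional_def)
      show "\<exists>g\<in>carrier (group_ring A G). g \<oplus>\<^bsub>group_ring A G\<^esub> f = \<zero>\<^bsub>group_ring A G\<^esub>"
        using inv[OF C] by (simp add: group_ring_def)
    qed (use zC in \<open>simp add: group_ring_def\<close>)
    show "monoid (group_ring A G)"
      using mC uC assoc lone rone by (intro monoidI) (simp_all add: group_ring_def)
  qed (use ldist rdist in \<open>simp_all add: group_ring_def\<close>)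
qed

end

theory Submission
  imports Defs
begin

text \<open>
  Everything is governed by the augmentation \<open>aug\<close>, the ring homomorphism from \<open>A[G]\<close> onto \<open>A\<close> that
  sends every group element to \<open>1\<close>. The preimage of a maximal left ideal \<open>M\<close> of \<open>A\<close> is a maximal left
  ideal of \<open>A[G]\<close>; hence if \<open>A[G]\<close> is local, so is \<open>A\<close>, and the maximal left ideal of \<open>A[G]\<close> is this
  preimage. Both directions of the theorem rest on the description of local rings by one-sided inverses:
  in a local ring everything outside the maximal left ideal has a left inverse
  (\<open>local_ring_left_inverse\<close>), and conversely a proper left ideal outside of which every element has a
  left inverse is the only maximal one (\<open>maximal_left_ideal_if_left_inverses\<close>).

  Suppose that \<open>A[G]\<close> is local. An element whose augmentation is outside \<open>M\<close> must then have a left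
  inverse, and suitable elements test this. If \<open>g\<close> has infinite order, then \<open>1 - g + g\<^sup>2\<close> has augmentation
  \<open>1\<close>, but no left inverse: as for Laurent polynomials, its lowest and its highest term both have
  coefficient \<open>1\<close>, so its nonzero left multiples have at least two terms. If \<open>g \<noteq> 1\<close> has
  finite order \<open>n\<close>, then the sum \<open>s\<close> of the powers of \<open>g\<close> has augmentation \<open>n\<close> and satisfies \<open>s g = s\<close>; a
  left inverse of \<open>s\<close> would give \<open>g = 1\<close>, so \<open>n \<in> M\<close>. Applied to powers of prime order this shows that
  every prime dividing the order of an element lies in \<open>M\<close>. By Bezout only one prime \<open>p\<close> can, and it is
  the characteristic of \<open>A/M\<close>.

  Conversely, let \<open>A\<close> be local with \<open>p \<in> M\<close>. First let \<open>G\<close> be a finite \<open>p\<close>-group and let \<open>L\<close> be any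
  maximal left ideal of \<open>A[G]\<close>. As \<open>A[G]\<close> is finitely generated over \<open>A\<close>, Nakayama's argument puts all
  elements with coefficients in \<open>M\<close> into \<open>L\<close> (\<open>coefficients_in_maximal_imp_mem\<close>). The image of \<open>\<int>[G]\<close> in
  \<open>A[G]/L\<close> is thus a nonzero finite vector space over the field with \<open>p\<close> elements, and by counting
  orbits the \<open>p\<close>-group \<open>G\<close> fixes a nonzero vector in it (\<open>exists_fixed_vector_mod\<close>). The fixed vectors of
  \<open>A[G]/L\<close> form a submodule, so by maximality \<open>G\<close> acts trivially on all of \<open>A[G]/L\<close>; then \<open>f\<close> and its
  augmentation agree modulo \<open>L\<close>, and \<open>L\<close> is the preimage of \<open>M\<close>. Hence \<open>A[G]\<close> is local. If \<open>G\<close> is only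
  locally finite, an element with augmentation outside \<open>M\<close> is supported in a finite subgroup \<open>H\<close>, and its
  left inverse in \<open>A[H]\<close> is also one in \<open>A[G]\<close>.
\<close>

section \<open>Maximal left ideals\<close>

text \<open>Closure under negation comes for free: \<open>-x\<close> is the product of \<open>-1\<close> and \<open>x\<close>.\<close>
lemma left_idealI:
  assumes "ring R" "I \<subseteq> carrier R" "\<zero>\<^bsub>R\<^esub> \<in> I"
    and "\<And>x y. x \<in> I \<Longrightarrow> y \<in> I \<Longrightarrow> x \<oplus>\<^bsub>R\<^esub> y \<in> I"
    and "\<And>a x. a \<in> carrier R \<Longrightarrow> x \<in> I \<Longrightarrow> a \<otimes>\<^bsub>R\<^esub> x \<in> I"
  shows "left_ideal I R"
proof -
  interpret R: ring R by fact
  have "subgroup I (add_monoid R)"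
  proof (rule group.subgroupI[OF R.add.is_group])
    fix x assume x: "x \<in> I"
    have "\<ominus>\<^bsub>R\<^esub> x = (\<ominus>\<^bsub>R\<^esub> \<one>\<^bsub>R\<^esub>) \<otimes>\<^bsub>R\<^esub> x"
      using assms(2) x by (simp add: R.l_minus subsetD)
    then have "\<ominus>\<^bsub>R\<^esub> x \<in> I" using assms(5)[OF _ x] by simp
    then show "inv\<^bsub>add_monoid R\<^esub> x \<in> I" by (simp add: a_inv_def)
  qed (use assms in auto)
  then show ?thesis
    using assms by (simp add: left_ideal_def left_ideal_axioms_def additive_subgroup_def)
qed

lemma (in left_ideal) eq_carrier_if_one: "\<one> \<in> I \<Longrightarrow> I = carrier R"
  using I_l_closed[of \<one>] a_subset by force

lemma (in maximal_left_ideal) one_notin: "\<one> \<notin> I"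
  using eq_carrier_if_one I_notcarr by blast

lemma (in left_ideal) minus_mem: "x \<in> I \<Longrightarrow> y \<in> I \<Longrightarrow> x \<ominus> y \<in> I"
  unfolding a_minus_def by auto

lemma (in left_ideal) is_abelian_subgroup: "abelian_subgroup I R"
  by (intro abelian_subgroupI3) unfold_locales

lemma (in ring) left_ideal_Union_chain:
  assumes "C \<noteq> {}" and "subset.chain {J. left_ideal J R} C"
  shows "left_ideal (\<Union>C) R"
proof (rule left_idealI)
  have L: "J \<in> C \<Longrightarrow> left_ideal J R" for J
    using assms(2) by (auto simp: subset_chain_def)
  show "\<Union>C \<subseteq> carrier R"
    using additive_subgroup.a_subset[OF left_ideal.axioms(1)[OF L]] by blast
  show "\<zero> \<in> \<Union>C"
    using assms(1) additive_subgroup.zero_closed[OF left_ideal.axioms(1)[OF L]] by blast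
  show "x \<oplus> y \<in> \<Union>C" if "x \<in> \<Union>C" "y \<in> \<Union>C" for x y
  proof -
    obtain J where J: "J \<in> C" "x \<in> J" "y \<in> J"
      using \<open>x \<in> \<Union>C\<close> \<open>y \<in> \<Union>C\<close> assms(2) unfolding subset_chain_def by blast
    then have "x \<oplus> y \<in> J"
      using additive_subgroup.a_closed[OF left_ideal.axioms(1)[OF L]] by blast
    then show ?thesis using J by blast
  qed
  show "a \<otimes> x \<in> \<Union>C" if "a \<in> carrier R" "x \<in> \<Union>C" for a x
    using left_ideal.I_l_closed[OF L] that by blast
qed (rule ring_axioms)

text \<open>Zorn's lemma applies because a left ideal is proper exactly if it misses \<open>\<one>\<close>, a property that survives
  unions of chains.\<close>
lemma (in ring) exists_maximal_left_ideal:
  assumes I: "left_ideal I R" and "\<one> \<notin> I"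
  shows "\<exists>J. maximal_left_ideal J R \<and> I \<subseteq> J"
proof -
  let ?P = "{J. left_ideal J R \<and> I \<subseteq> J \<and> \<one> \<notin> J}"
  have "\<exists>J\<in>?P. \<forall>N\<in>?P. J \<subseteq> N \<longrightarrow> N = J"
  proof (rule subset_Zorn)
    fix C assume C: "subset.chain ?P C"
    show "\<exists>U\<in>?P. \<forall>N\<in>C. N \<subseteq> U"
    proof (cases "C = {}")
      case True
      then show ?thesis using assms by blast
    next
      case False
      have "subset.chain {J. left_ideal J R} C"
        using C by (auto simp: subset_chain_def)
      then have "left_ideal (\<Union>C) R"
        by (rule left_ideal_Union_chain[OF False])
      then have "\<Union>C \<in> ?P" using C False by (auto simp: subset_chain_def)
      then show ?thesis by blast
    qed
  qed
  then obtain J where J: "J \<in> ?P" and m: "\<forall>N\<in>?P. J \<subseteq> N \<longrightarrow> N = J"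
    by (rule bexE)
  interpret J: left_ideal J R using J by simp
  have "maximal_left_ideal J R"
  proof
    show "carrier R \<noteq> J" using J by auto
    fix N assume N: "left_ideal N R" "J \<subseteq> N"
    then show "N = J \<or> N = carrier R"
      using bspec[OF m, of N] J left_ideal.eq_carrier_if_one[of N R] by blast
  qed
  then show ?thesis using J by blast
qed

lemma (in ring) principal_left_ideal:
  assumes "x \<in> carrier R"
  shows "left_ideal {y \<otimes> x |y. y \<in> carrier R} R"
proof (rule left_idealI)
  show "\<zero> \<in> {y \<otimes> x |y. y \<in> carrier R}" using l_null[OF assms] zero_closed by (metis (mono_tags, lifting) mem_Collect_eq)
  show "u \<oplus> v \<in> {y \<otimes> x |y. y \<in> carrier R}"
    if "u \<in> {y \<otimes> x |y. y \<in> carrier R}" "v \<in> {y \<otimes> x |y. y \<in> carrier R}" for u v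
    using that assms by (force simp: l_distr[symmetric])
  show "a \<otimes> u \<in> {y \<otimes> x |y. y \<in> carrier R}"
    if "a \<in> carrier R" "u \<in> {y \<otimes> x |y. y \<in> carrier R}" for a u
    using that assms by (force simp: m_assoc[symmetric])
qed (use assms ring_axioms in auto)

text \<open>Without a left inverse of \<open>x\<close>, the left ideal generated by \<open>x\<close> is proper, so it lies in a maximal
  left ideal, and \<open>M\<close> is the only one.\<close>
lemma local_ring_left_inverse:
  assumes "local_ring R" and M: "maximal_left_ideal M R" and x: "x \<in> carrier R" "x \<notin> M"
  shows "\<exists>y\<in>carrier R. y \<otimes>\<^bsub>R\<^esub> x = \<one>\<^bsub>R\<^esub>"
proof (rule ccontr)
  interpret local_ring R by fact
  assume "\<not> ?thesis"
  then have "\<one>\<^bsub>R\<^esub> \<notin> {y \<otimes>\<^bsub>R\<^esub> x |y. y \<in> carrier R}" by force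
  then obtain J where J: "maximal_left_ideal J R" "{y \<otimes>\<^bsub>R\<^esub> x |y. y \<in> carrier R} \<subseteq> J"
    using exists_maximal_left_ideal principal_left_ideal x by meson
  have "\<one>\<^bsub>R\<^esub> \<otimes>\<^bsub>R\<^esub> x \<in> J" using J(2) one_closed by blast
  then have "x \<in> J" using x by simp
  then show False
    using J M x unique_maximal_left_ideal by blast
qed

text \<open>The converse of \<open>local_ring_left_inverse\<close>: an element outside \<open>M\<close> generates the whole ring, so \<open>M\<close>
  contains every proper left ideal.\<close>
lemma maximal_left_ideal_if_left_inverses:
  assumes "left_ideal M R" "\<one>\<^bsub>R\<^esub> \<notin> M"
    and inv: "\<And>x. x \<in> carrier R \<Longrightarrow> x \<notin> M \<Longrightarrow> \<exists>y\<in>carrier R. y \<otimes>\<^bsub>R\<^esub> x = \<one>\<^bsub>R\<^esub>"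
  shows "maximal_left_ideal M R \<and> local_ring R"
proof -
  interpret left_ideal M R by fact
  have sub: "J \<subseteq> M" if J: "left_ideal J R" "J \<noteq> carrier R" for J
  proof
    fix x assume x: "x \<in> J"
    interpret J: left_ideal J R by fact
    show "x \<in> M"
    proof (rule ccontr)
      assume "x \<notin> M"
      then obtain y where "y \<in> carrier R" "y \<otimes>\<^bsub>R\<^esub> x = \<one>\<^bsub>R\<^esub>"
        using inv x J.a_subset by blast
      then show False using J.I_l_closed[OF x] J(2) J.eq_carrier_if_one by metis
    qed
  qed
  have max: "maximal_left_ideal M R"
    by unfold_locales (use assms(2) sub in auto)
  moreover have "J = M" if J: "maximal_left_ideal J R" for J
  proof -
    interpret J: maximal_left_ideal J R by fact
    have "J \<subseteq> M" using sub J.left_ideal_axioms J.I_notcarr by blast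
    then show ?thesis
      using J.I_maximal[OF left_ideal_axioms _ a_subset] assms(2) one_closed by blast
  qed
  ultimately have "\<exists>!J. maximal_left_ideal J R" by blast
  then show ?thesis
    using max ring_axioms by (simp add: local_ring_def local_ring_axioms_def)
qed

text \<open>This makes \<open>M\<close> a two-sided ideal. If \<open>m \<otimes> x\<close> had a left inverse \<open>y\<close>, then \<open>z = y \<otimes> m\<close> would be a left
  inverse of \<open>x\<close> inside \<open>M\<close>. Now \<open>1 - x z\<close> kills \<open>x\<close> from the left, but it is left invertible because
  \<open>x z \<in> M\<close>; so \<open>x = 0\<close>, contradicting \<open>z x = 1\<close>.\<close>
lemma local_ring_maximal_r_closed:
  assumes "local_ring R" and M: "maximal_left_ideal M R"
    and m: "m \<in> M" and x: "x \<in> carrier R"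
  shows "m \<otimes>\<^bsub>R\<^esub> x \<in> M"
proof (rule ccontr)
  interpret maximal_left_ideal M R by fact
  have mc: "m \<in> carrier R" using m a_subset by blast
  assume "m \<otimes>\<^bsub>R\<^esub> x \<notin> M"
  then obtain y where y: "y \<in> carrier R" "y \<otimes>\<^bsub>R\<^esub> (m \<otimes>\<^bsub>R\<^esub> x) = \<one>\<^bsub>R\<^esub>"
    using local_ring_left_inverse[OF assms(1,2)] x mc by blast
  define z where "z = y \<otimes>\<^bsub>R\<^esub> m"
  have z: "z \<in> M" "z \<in> carrier R" "z \<otimes>\<^bsub>R\<^esub> x = \<one>\<^bsub>R\<^esub>"
    using y m mc x I_l_closed by (auto simp: z_def m_assoc)
  have xz: "x \<otimes>\<^bsub>R\<^esub> z \<in> M" using z x I_l_closed by blast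
  have "\<one>\<^bsub>R\<^esub> \<ominus>\<^bsub>R\<^esub> x \<otimes>\<^bsub>R\<^esub> z \<notin> M"
  proof
    assume "\<one>\<^bsub>R\<^esub> \<ominus>\<^bsub>R\<^esub> x \<otimes>\<^bsub>R\<^esub> z \<in> M"
    from additive_subgroup.a_closed[OF additive_subgroup_axioms this xz]
    have "\<one>\<^bsub>R\<^esub> \<in> M" using x z(2) by (simp add: a_minus_def a_assoc l_neg)
    then show False using one_notin by blast
  qed
  then obtain u where u: "u \<in> carrier R" "u \<otimes>\<^bsub>R\<^esub> (\<one>\<^bsub>R\<^esub> \<ominus>\<^bsub>R\<^esub> x \<otimes>\<^bsub>R\<^esub> z) = \<one>\<^bsub>R\<^esub>"
    using local_ring_left_inverse[OF assms(1,2) minus_closed[OF one_closed m_closed[OF x z(2)]]]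
    by blast
  have "(\<one>\<^bsub>R\<^esub> \<ominus>\<^bsub>R\<^esub> x \<otimes>\<^bsub>R\<^esub> z) \<otimes>\<^bsub>R\<^esub> x = x \<ominus>\<^bsub>R\<^esub> x \<otimes>\<^bsub>R\<^esub> (z \<otimes>\<^bsub>R\<^esub> x)"
    using x z(2) by (simp add: a_minus_def l_distr l_minus m_assoc)
  also have "\<dots> = \<zero>\<^bsub>R\<^esub>" using x z by (simp add: a_minus_def r_neg)
  finally have "(\<one>\<^bsub>R\<^esub> \<ominus>\<^bsub>R\<^esub> x \<otimes>\<^bsub>R\<^esub> z) \<otimes>\<^bsub>R\<^esub> x = \<zero>\<^bsub>R\<^esub>" .
  then have "u \<otimes>\<^bsub>R\<^esub> (\<one>\<^bsub>R\<^esub> \<ominus>\<^bsub>R\<^esub> x \<otimes>\<^bsub>R\<^esub> z) \<otimes>\<^bsub>R\<^esub> x = \<zero>\<^bsub>R\<^esub>"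
    using u(1) x z(2) by (subst m_assoc) simp_all
  then have "x = \<zero>\<^bsub>R\<^esub>" using u(2) x by simp
  then have "\<one>\<^bsub>R\<^esub> = \<zero>\<^bsub>R\<^esub>" using z by simp
  then show False using one_notin zero_closed by simp
qed

section \<open>Characteristic of the residue ring\<close>

lemma (in left_ideal) add_pow_Quot:
  "add_pow (R Quot I) n \<one>\<^bsub>R Quot I\<^esub> = I +> add_pow R (n::nat) \<one>"
proof (induction n)
  case 0
  interpret abelian_subgroup I R by (rule is_abelian_subgroup)
  show ?case using a_subset by (simp add: FactRing_def add_pow_def nat_pow_def)
next
  case (Suc n)
  interpret abelian_subgroup I R by (rule is_abelian_subgroup)
  have "add_pow (R Quot I) (Suc n) \<one>\<^bsub>R Quot I\<^esub> = (I +> add_pow R n \<one>) <+> (I +> \<one>)"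
    using Suc by (simp add: FactRing_def add_pow_def nat_pow_def)
  then show ?case by (simp add: a_rcos_sum)
qed

lemma (in left_ideal) add_pow_Quot_eq_zero:
  "add_pow (R Quot I) n \<one>\<^bsub>R Quot I\<^esub> = \<zero>\<^bsub>R Quot I\<^esub> \<longleftrightarrow> add_pow R (n::nat) \<one> \<in> I"
proof -
  interpret abelian_subgroup I R by (rule is_abelian_subgroup)
  have "I +> add_pow R n \<one> = I \<longleftrightarrow> add_pow R n \<one> \<in> I"
    by (metis a_coset_add_zero a_rcos_const a_rcos_self a_subset add.nat_pow_closed one_closed)
  then show ?thesis unfolding add_pow_Quot by (simp add: FactRing_def)
qed

text \<open>The integers \<open>n\<close> with \<open>n \<cdot> \<one> \<in> I\<close> form a subgroup of the integers, to which Bezout's identity applies.\<close>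
lemma (in left_ideal) one_in_if_coprime:
  assumes "coprime m n" "add_pow R (m::nat) \<one> \<in> I" "add_pow R (n::nat) \<one> \<in> I"
  shows "\<one> \<in> I"
proof -
  have mult: "add_pow R (k * l) \<one> \<in> I" if "add_pow R l \<one> \<in> I" for k l :: nat
  proof (induction k)
    case (Suc k)
    then show ?case using that by (simp add: add.nat_pow_mult[symmetric])
  qed simp
  show ?thesis
  proof (cases "n = 0")
    case True
    then show ?thesis using assms by simp
  next
    case False
    have "gcd n m = 1" using assms(1) by (simp add: coprime_iff_gcd_eq_1 gcd.commute)
    then obtain x y where "n * x = m * y + 1"
      using bezout_nat[OF False, of m] by metis
    then have "add_pow R (x * n) \<one> = add_pow R (y * m) \<one> \<oplus> \<one>"
      by (simp add: mult.commute)
    then have "\<one> = add_pow R (x * n) \<one> \<ominus> add_pow R (y * m) \<one>"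
      by (simp add: a_minus_def a_ac r_neg)
    then show ?thesis using minus_mem mult assms by metis
  qed
qed

text \<open>If \<open>p \<cdot> \<one> \<in> I\<close> but \<open>n \<cdot> \<one> \<in> I\<close> already for some positive \<open>n < p\<close>, then \<open>n\<close> is coprime to \<open>p\<close> and \<open>\<one>\<close>
  itself would lie in \<open>I\<close>.\<close>
lemma (in maximal_left_ideal) ring_char_Quot_eq_prime_iff:
  assumes p: "Factorial_Ring.prime p"
  shows "ring_char (R Quot I) = p \<longleftrightarrow> add_pow R (p::nat) \<one> \<in> I"
proof
  assume "ring_char (R Quot I) = p"
  then show "add_pow R p \<one> \<in> I"
    using prime_gt_0_nat[OF p] unfolding ring_char_def add_pow_Quot_eq_zero
    by (metis (mono_tags, lifting) LeastI_ex less_not_refl)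
next
  assume a: "add_pow R p \<one> \<in> I"
  have min: "p \<le> n" if n: "n > 0 \<and> add_pow R n \<one> \<in> I" for n :: nat
  proof (rule ccontr)
    assume "\<not> p \<le> n"
    then have "coprime n p"
      using n p by (metis coprime_commute dvd_imp_le prime_imp_coprime_nat)
    then show False using one_in_if_coprime[OF _ _ a] n one_notin by blast
  qed
  then have "(LEAST n. n > 0 \<and> add_pow R n \<one> \<in> I) = p"
    using a prime_gt_0_nat[OF p] by (intro Least_equality) auto
  then show "ring_char (R Quot I) = p"
    using a prime_gt_0_nat[OF p] unfolding ring_char_def add_pow_Quot_eq_zero by auto
qed

section \<open>Groups of prime power order\<close>

text \<open>The library defines an action as a homomorphism into the group of extensional bijections of \<open>E\<close>. Here it
  is obtained from the usual axioms; \<open>a (inv g)\<close> provides the inverse of \<open>a g\<close>.\<close>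
lemma group_actionI:
  assumes "group G"
    and cl: "\<And>g x. g \<in> carrier G \<Longrightarrow> x \<in> E \<Longrightarrow> a g x \<in> E"
    and one: "\<And>x. x \<in> E \<Longrightarrow> a \<one>\<^bsub>G\<^esub> x = x"
    and mult: "\<And>g h x. g \<in> carrier G \<Longrightarrow> h \<in> carrier G \<Longrightarrow> x \<in> E \<Longrightarrow> a (g \<otimes>\<^bsub>G\<^esub> h) x = a g (a h x)"
  shows "group_action G E (\<lambda>g. \<lambda>x\<in>E. a g x)"
proof -
  interpret group G by fact
  have bij: "(\<lambda>x\<in>E. a g x) \<in> Bij E" if g: "g \<in> carrier G" for g
  proof -
    have "bij_betw (\<lambda>x\<in>E. a g x) E E"
      using g by (intro bij_betwI[where g = "a (inv\<^bsub>G\<^esub> g)"]) (auto simp: cl one mult[symmetric])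
    then show ?thesis by (simp add: Bij_def)
  qed
  have "(\<lambda>g. \<lambda>x\<in>E. a g x) \<in> hom G (BijGroup E)"
    using bij by (intro homI) (auto simp: BijGroup_def compose_def mult cl fun_eq_iff)
  then show ?thesis
    using group_BijGroup
    by (auto simp: group_action_def group_hom_def group_hom_axioms_def group_axioms)
qed

text \<open>The class equation: an orbit that is not a single point has a size dividing \<open>p ^ n\<close> and different from
  \<open>1\<close>, hence divisible by \<open>p\<close>. So the number of fixed points is divisible by \<open>p\<close>, and it cannot be \<open>1\<close>.\<close>
lemma (in group_action) fixed_point_p_group:
  assumes p: "Factorial_Ring.prime p" and ord: "order G = p ^ n"
    and fin: "finite E" and dvd: "p dvd card E"
    and x: "x \<in> E" and fx: "\<And>g. g \<in> carrier G \<Longrightarrow> \<phi> g x = x"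
  shows "\<exists>y\<in>E. y \<noteq> x \<and> (\<forall>g\<in>carrier G. \<phi> g y = y)"
proof (rule ccontr)
  assume no: "\<not> ?thesis"
  interpret group_hom G "BijGroup E" \<phi> by (rule group_hom)
  have part: "partition E (orbits G E \<phi>)" by (rule orbit_partition)
  have sub: "B \<subseteq> E" if "B \<in> orbits G E \<phi>" for B
    using that element_image by (auto simp: orbits_def orbit_def)
  then have "orbits G E \<phi> \<subseteq> Pow E" by blast
  then have fino: "finite (orbits G E \<phi>)" using fin finite_subset by blast
  \<comment> \<open>If \<open>x\<close> is the only fixed point, its orbit is the only one of size prime to \<open>p\<close>, which would make \<open>card E\<close> congruent to \<open>1\<close>.\<close>
  have ox: "orbit G \<phi> x = {x}" using fx[symmetric] G.one_closed by (auto simp: orbit_def)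
  then have xo: "{x} \<in> orbits G E \<phi>" using x by (auto simp: orbits_def)
  have d: "p dvd card B" if B: "B \<in> orbits G E \<phi> - {{x}}" for B
  proof -
    obtain y where y: "y \<in> E" "B = orbit G \<phi> y" using B by (auto simp: orbits_def)
    have "y \<noteq> x" using y B ox by auto
    then obtain g where g: "g \<in> carrier G" "\<phi> g y \<noteq> y" using no y by blast
    have "card B \<noteq> 1"
    proof
      assume "card B = 1"
      moreover have "y \<in> B" "\<phi> g y \<in> B" using y g orbit_refl by (auto simp: orbit_def)
      ultimately show False using g by (metis card_1_singletonE singletonD)
    qed
    moreover have "card B dvd p ^ n"
      using orbit_stabilizer_theorem[OF y(1)] y(2) ord by (metis dvd_triv_left)
    ultimately show ?thesis
      using p by (metis divides_primepow_nat dvd_power not_gr_zero power_0)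
  qed
  have "card E = (\<Sum>B\<in>orbits G E \<phi>. card B)"
    using partition.disjoint_sum[OF part fin, of "\<lambda>_. 1::nat"] by simp
  also have "\<dots> = 1 + (\<Sum>B\<in>orbits G E \<phi> - {{x}}. card B)"
    using fino xo by (simp add: sum.remove)
  finally have "card E = 1 + (\<Sum>B\<in>orbits G E \<phi> - {{x}}. card B)" .
  moreover have "p dvd (\<Sum>B\<in>orbits G E \<phi> - {{x}}. card B)" using d by (rule dvd_sum)
  ultimately have "p dvd 1" using dvd by (metis dvd_add_left_iff)
  then show False using p by simp
qed

lemma (in group) ord_eq_prime:
  assumes "x \<in> carrier G" "x \<noteq> \<one>" "Factorial_Ring.prime q" "x [^] (q::nat) = \<one>"
  shows "ord x = q"
  using assms by (metis ord_eq_1 pow_eq_id prime_nat_iff)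

lemma (in group) exists_element_of_prime_ord:
  assumes x: "x \<in> carrier G" "ord x \<noteq> 0" and q: "Factorial_Ring.prime q" "q dvd ord x"
  shows "\<exists>y\<in>carrier G. y \<noteq> \<one> \<and> ord y = q"
proof -
  obtain k where k: "ord x = q * k" using q by blast
  have "k > 0" using k x by auto
  have "x [^] k \<noteq> \<one>"
  proof
    assume "x [^] k = \<one>"
    then have "q * k dvd 1 * k" using k x pow_eq_id by simp
    then have "q dvd 1" using \<open>k > 0\<close> by (simp only: dvd_times_right_cancel_iff[of k] neq0_conv not_gr_zero)
    then show False using q by simp
  qed
  moreover have "(x [^] k) [^] q = \<one>"
    using x k by (metis mult.commute nat_pow_pow pow_ord_eq_1)
  ultimately show ?thesis using ord_eq_prime x q by blast
qed

lemma power_if_only_prime_divisor: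
  fixes n :: nat
  assumes "n \<noteq> 0" and "\<And>q. Factorial_Ring.prime q \<Longrightarrow> q dvd n \<Longrightarrow> q = p"
  shows "\<exists>k. n = p ^ k"
proof -
  have "prime_factors n \<subseteq> {p}" using assms by (auto simp: prime_factors_dvd)
  then have "(\<Prod>q\<in>prime_factors n. q ^ multiplicity q n) = p ^ (if prime_factors n = {} then 0 else multiplicity p n)"
    by (auto simp: subset_singleton_iff)
  then show ?thesis using assms(1) by (metis prime_factorization_nat not_gr_zero)
qed

text \<open>By Sylow's theorem a prime \<open>q\<close> dividing the order of \<open>G\<close> is the order of a subgroup, hence of an element.\<close>
lemma finite_p_group_order:
  fixes G (structure)
  assumes G: "p_group p G" and p: "Factorial_Ring.prime p" and fin: "finite (carrier G)"
  shows "\<exists>n. order G = p ^ n"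
proof (rule power_if_only_prime_divisor)
  interpret group G using G by (simp add: p_group_def)
  show "order G \<noteq> 0" using fin order_gt_0_iff_finite by simp
  fix q :: nat assume q: "Factorial_Ring.prime q" "q dvd order G"
  then obtain m where "order G = q ^ 1 * m" by auto
  then obtain H where H: "subgroup H G" "card H = q"
    using sylow_thm[OF q(1) group_axioms _ fin, of 1 m] by auto
  interpret H: group "G\<lparr>carrier := H\<rparr>" using H subgroup.subgroup_is_group group_axioms by blast
  have "H \<noteq> {\<one>}" using H q by auto
  then obtain x where x: "x \<in> H" "x \<noteq> \<one>" using H subgroup.one_closed by blast
  have xG: "x \<in> carrier G" using x H subgroup.subset by blast
  have "x [^]\<^bsub>G\<lparr>carrier := H\<rparr>\<^esub> q = \<one>"
    using H.pow_order_eq_1[of x] x H by (simp add: order_def)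
  then have "x [^] q = \<one>" using nat_pow_consistent by metis
  then have "ord x = q" using ord_eq_prime xG x q by blast
  then obtain k where "q = p ^ k" using G xG unfolding p_group_def by metis
  then show "q = p" using q p by (metis prime_dvd_power primes_dvd_imp_eq dvd_refl)
qed

section \<open>Monomials and the augmentation\<close>

locale ring_and_group = A: ring A + G: group G
  for A :: "('a, 'm) ring_scheme" and G :: "('g, 'n) monoid_scheme"

sublocale ring_and_group \<subseteq> AG: ring "group_ring A G"
  by (intro group_ring_is_ring) unfold_locales

context ring_and_group
begin

abbreviation "AG \<equiv> group_ring A G"

definition single :: "'a \<Rightarrow> 'g \<Rightarrow> 'g \<Rightarrow> 'a" where
  "single a g = (\<lambda>x\<in>carrier G. if x = g then a else \<zero>\<^bsub>A\<^esub>)"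

text \<open>The augmentation: the ring homomorphism from \<open>A[G]\<close> onto \<open>A\<close> that extends the identity of \<open>A\<close> and
  sends every group element to \<open>1\<close>.\<close>
definition aug :: "('g \<Rightarrow> 'a) \<Rightarrow> 'a" where
  "aug f = (\<Oplus>\<^bsub>A\<^esub>x\<in>supp A G f. f x)"

lemma carrier_AG: "f \<in> carrier AG \<longleftrightarrow> f \<in> carrier G \<rightarrow>\<^sub>E carrier A \<and> finite (supp A G f)"
  by (simp add: group_ring_def)

lemma coeff_closed [simp]: "f \<in> carrier AG \<Longrightarrow> x \<in> carrier G \<Longrightarrow> f x \<in> carrier A"
  by (auto simp: carrier_AG)

lemma finite_supp [simp]: "f \<in> carrier AG \<Longrightarrow> finite (supp A G f)"
  by (simp add: carrier_AG)

lemma supp_subset: "supp A G f \<subseteq> carrier G"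
  by (auto simp: supp_def)

lemma AG_eqI:
  "f \<in> carrier AG \<Longrightarrow> h \<in> carrier AG \<Longrightarrow> (\<And>x. x \<in> carrier G \<Longrightarrow> f x = h x) \<Longrightarrow> f = h"
  by (auto simp: carrier_AG intro: PiE_ext)

lemma AG_memI:
  assumes "\<And>x. x \<in> carrier G \<Longrightarrow> f x \<in> carrier A" "f \<in> extensional (carrier G)"
    and "finite S" "\<And>x. x \<in> carrier G \<Longrightarrow> x \<notin> S \<Longrightarrow> f x = \<zero>\<^bsub>A\<^esub>"
  shows "f \<in> carrier AG"
proof -
  have "supp A G f \<subseteq> S" using assms(4) by (auto simp: supp_def)
  then have "finite (supp A G f)" using assms(3) by (rule finite_subset)
  then show ?thesis using assms(1,2) by (simp add: carrier_AG PiE_def del: finite_supp)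
qed

lemma zero_coeff [simp]: "x \<in> carrier G \<Longrightarrow> \<zero>\<^bsub>AG\<^esub> x = \<zero>\<^bsub>A\<^esub>"
  by (simp only: group_ring_def ring.select_convs restrict_apply')

lemma add_coeff [simp]: "x \<in> carrier G \<Longrightarrow> (f \<oplus>\<^bsub>AG\<^esub> h) x = f x \<oplus>\<^bsub>A\<^esub> h x"
  by (simp only: group_ring_def ring.select_convs restrict_apply')

text \<open>The additive inverse is not part of the record that defines the group ring, so its coefficients are
  found from the cancellation law.\<close>
lemma minus_coeff [simp]:
  assumes "f \<in> carrier AG" "h \<in> carrier AG" "x \<in> carrier G"
  shows "(f \<ominus>\<^bsub>AG\<^esub> h) x = f x \<ominus>\<^bsub>A\<^esub> h x"
proof -
  have "(f \<ominus>\<^bsub>AG\<^esub> h) \<oplus>\<^bsub>AG\<^esub> h = f"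
    using assms by (simp add: a_minus_def AG.a_assoc AG.l_neg)
  then have "(f \<ominus>\<^bsub>AG\<^esub> h) x \<oplus>\<^bsub>A\<^esub> h x = f x" using assms(3) add_coeff by metis
  then have "f x \<ominus>\<^bsub>A\<^esub> h x = ((f \<ominus>\<^bsub>AG\<^esub> h) x \<oplus>\<^bsub>A\<^esub> h x) \<ominus>\<^bsub>A\<^esub> h x" by simp
  also have "\<dots> = (f \<ominus>\<^bsub>AG\<^esub> h) x"
    using assms by (simp add: a_minus_def A.a_assoc A.r_neg del: add_coeff)
  finally show ?thesis by simp
qed

lemma one_eq_single: "\<one>\<^bsub>AG\<^esub> = single \<one>\<^bsub>A\<^esub> \<one>\<^bsub>G\<^esub>"
  by (simp only: group_ring_def monoid.select_convs single_def)

lemma single_coeff [simp]: "x \<in> carrier G \<Longrightarrow> single a g x = (if x = g then a else \<zero>\<^bsub>A\<^esub>)"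
  by (simp add: single_def)

lemma single_closed [simp]: "a \<in> carrier A \<Longrightarrow> single a g \<in> carrier AG"
  by (rule AG_memI[where S = "{g}"]) (auto simp: single_def)

lemma supp_single: "supp A G (single a g) \<subseteq> {g}"
  by (auto simp: supp_def split: if_splits)

text \<open>The defining sum runs over the support of \<open>f\<close>; a larger finite index set adds only zero terms and can
  be chosen to fit the situation.\<close>
lemma mult_coeff:
  assumes "f \<in> carrier AG" "h \<in> carrier AG" "x \<in> carrier G"
    and S: "finite S" "supp A G f \<subseteq> S" "S \<subseteq> carrier G"
  shows "(f \<otimes>\<^bsub>AG\<^esub> h) x = (\<Oplus>\<^bsub>A\<^esub>y\<in>S. f y \<otimes>\<^bsub>A\<^esub> h (inv\<^bsub>G\<^esub> y \<otimes>\<^bsub>G\<^esub> x))"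
proof -
  have "(\<Oplus>\<^bsub>A\<^esub>y\<in>supp A G f. f y \<otimes>\<^bsub>A\<^esub> h (inv\<^bsub>G\<^esub> y \<otimes>\<^bsub>G\<^esub> x))
      = (\<Oplus>\<^bsub>A\<^esub>y\<in>S. f y \<otimes>\<^bsub>A\<^esub> h (inv\<^bsub>G\<^esub> y \<otimes>\<^bsub>G\<^esub> x))"
  proof (rule A.add.finprod_mono_neutral_cong_left[OF S(1,2)])
    fix y assume "y \<in> S - supp A G f"
    then have "y \<in> carrier G" "f y = \<zero>\<^bsub>A\<^esub>" using S(3) by (auto simp: supp_def)
    then show "f y \<otimes>\<^bsub>A\<^esub> h (inv\<^bsub>G\<^esub> y \<otimes>\<^bsub>G\<^esub> x) = \<zero>\<^bsub>A\<^esub>" using assms by simp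
  qed (use assms in auto)
  then show ?thesis
    using assms(3) by (simp only: group_ring_def monoid.select_convs restrict_apply')
qed

lemma single_mult_coeff [simp]:
  assumes "a \<in> carrier A" "g \<in> carrier G" "f \<in> carrier AG" "x \<in> carrier G"
  shows "(single a g \<otimes>\<^bsub>AG\<^esub> f) x = a \<otimes>\<^bsub>A\<^esub> f (inv\<^bsub>G\<^esub> g \<otimes>\<^bsub>G\<^esub> x)"
proof -
  have "(single a g \<otimes>\<^bsub>AG\<^esub> f) x = (\<Oplus>\<^bsub>A\<^esub>y\<in>{g}. single a g y \<otimes>\<^bsub>A\<^esub> f (inv\<^bsub>G\<^esub> y \<otimes>\<^bsub>G\<^esub> x))"
    using assms by (intro mult_coeff) (auto simp: supp_single)
  then show ?thesis using assms by simp
qed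

lemma mult_single_coeff [simp]:
  assumes "a \<in> carrier A" "g \<in> carrier G" "f \<in> carrier AG" "x \<in> carrier G"
  shows "(f \<otimes>\<^bsub>AG\<^esub> single a g) x = f (x \<otimes>\<^bsub>G\<^esub> inv\<^bsub>G\<^esub> g) \<otimes>\<^bsub>A\<^esub> a"
proof -
  let ?z = "x \<otimes>\<^bsub>G\<^esub> inv\<^bsub>G\<^esub> g"
  let ?S = "insert ?z (supp A G f)"
  have S: "?S \<subseteq> carrier G" using assms supp_subset by auto
  have "(f \<otimes>\<^bsub>AG\<^esub> single a g) x = (\<Oplus>\<^bsub>A\<^esub>y\<in>?S. f y \<otimes>\<^bsub>A\<^esub> single a g (inv\<^bsub>G\<^esub> y \<otimes>\<^bsub>G\<^esub> x))"
    using assms S by (intro mult_coeff) auto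
  also have "\<dots> = (\<Oplus>\<^bsub>A\<^esub>y\<in>?S. if ?z = y then f y \<otimes>\<^bsub>A\<^esub> a else \<zero>\<^bsub>A\<^esub>)"
  proof (rule A.finsum_cong')
    fix y assume "y \<in> ?S"
    then have y: "y \<in> carrier G" using S by auto
    have "inv\<^bsub>G\<^esub> y \<otimes>\<^bsub>G\<^esub> x = g \<longleftrightarrow> ?z = y"
      using y assms by (metis G.inv_closed G.inv_solve_left G.inv_solve_right' G.m_closed)
    then show "f y \<otimes>\<^bsub>A\<^esub> single a g (inv\<^bsub>G\<^esub> y \<otimes>\<^bsub>G\<^esub> x) = (if ?z = y then f y \<otimes>\<^bsub>A\<^esub> a else \<zero>\<^bsub>A\<^esub>)"
      using assms y by auto
  qed (use S assms in auto)
  also have "\<dots> = f ?z \<otimes>\<^bsub>A\<^esub> a"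
    using assms S by (intro A.add.finprod_singleton) auto
  finally show ?thesis .
qed

lemma single_mult_single:
  assumes "a \<in> carrier A" "b \<in> carrier A" "g \<in> carrier G" "h \<in> carrier G"
  shows "single a g \<otimes>\<^bsub>AG\<^esub> single b h = single (a \<otimes>\<^bsub>A\<^esub> b) (g \<otimes>\<^bsub>G\<^esub> h)"
proof (rule AG_eqI)
  fix x assume x: "x \<in> carrier G"
  have "inv\<^bsub>G\<^esub> g \<otimes>\<^bsub>G\<^esub> x = h \<longleftrightarrow> x = g \<otimes>\<^bsub>G\<^esub> h"
    using x assms by (metis G.inv_solve_left')
  then show "(single a g \<otimes>\<^bsub>AG\<^esub> single b h) x = single (a \<otimes>\<^bsub>A\<^esub> b) (g \<otimes>\<^bsub>G\<^esub> h) x"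
    using x assms by (simp del: mult_single_coeff)
qed (use assms in auto)

text \<open>An element is built up from its own terms: the monomial added in the step has the coefficient \<open>f g\<close>, so
  that a condition on the coefficients of \<open>f\<close> remains usable during the induction.\<close>
lemma AG_induct [consumes 1, case_names zero single_add]:
  assumes f: "f \<in> carrier AG" and "P \<zero>\<^bsub>AG\<^esub>"
    and step: "\<And>g h. g \<in> carrier G \<Longrightarrow> h \<in> carrier AG \<Longrightarrow> P h \<Longrightarrow> P (single (f g) g \<oplus>\<^bsub>AG\<^esub> h)"
  shows "P f"
proof -
  let ?r = "\<lambda>S. \<lambda>x\<in>carrier G. if x \<in> S then f x else \<zero>\<^bsub>A\<^esub>"
  have r: "?r S \<in> carrier AG" if "finite S" for S
    using f that by (intro AG_memI[of _ S]) auto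
  have "P (?r S)" if "finite S" "S \<subseteq> carrier G" for S
    using that
  proof (induction S)
    case empty
    have "?r {} = \<zero>\<^bsub>AG\<^esub>" using r[of "{}"] by (intro AG_eqI) auto
    then show ?case using assms(2) by simp
  next
    case (insert g S)
    then have g: "g \<in> carrier G" by simp
    have "?r (insert g S) = single (f g) g \<oplus>\<^bsub>AG\<^esub> ?r S"
      using insert f r[of S] r[of "insert g S"] g by (intro AG_eqI) auto
    moreover have "P (?r S)" by (rule insert.IH) (use insert.prems in simp)
    ultimately show ?case using step[OF g r[of S]] insert(1) by (simp only:)
  qed
  from this[of "supp A G f"] have "P (?r (supp A G f))" using f supp_subset by simp
  moreover have "?r (supp A G f) = f"
    by (rule AG_eqI[OF r[OF finite_supp[OF f]] f]) (simp add: supp_def)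
  ultimately show ?thesis by simp
qed

lemma aug_eq_sum:
  assumes "f \<in> carrier AG" "finite S" "supp A G f \<subseteq> S" "S \<subseteq> carrier G"
  shows "aug f = (\<Oplus>\<^bsub>A\<^esub>x\<in>S. f x)"
  unfolding aug_def
  by (rule A.add.finprod_mono_neutral_cong_left) (use assms in \<open>auto simp: supp_def\<close>)

lemma aug_closed [simp]: "f \<in> carrier AG \<Longrightarrow> aug f \<in> carrier A"
  unfolding aug_def by (intro A.finsum_closed) (auto simp: supp_def)

lemma aug_add [simp]:
  assumes "f \<in> carrier AG" "h \<in> carrier AG"
  shows "aug (f \<oplus>\<^bsub>AG\<^esub> h) = aug f \<oplus>\<^bsub>A\<^esub> aug h"
proof -
  let ?S = "supp A G f \<union> supp A G h"
  have S: "finite ?S" "?S \<subseteq> carrier G" using assms supp_subset by auto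
  have "aug (f \<oplus>\<^bsub>AG\<^esub> h) = (\<Oplus>\<^bsub>A\<^esub>x\<in>?S. (f \<oplus>\<^bsub>AG\<^esub> h) x)"
    using S assms by (intro aug_eq_sum) (auto simp: supp_def)
  also have "\<dots> = (\<Oplus>\<^bsub>A\<^esub>x\<in>?S. f x \<oplus>\<^bsub>A\<^esub> h x)"
    using S assms by (intro A.finsum_cong') auto
  also have "\<dots> = (\<Oplus>\<^bsub>A\<^esub>x\<in>?S. f x) \<oplus>\<^bsub>A\<^esub> (\<Oplus>\<^bsub>A\<^esub>x\<in>?S. h x)"
    using S assms by (intro A.finsum_addf) auto
  also have "\<dots> = aug f \<oplus>\<^bsub>A\<^esub> aug h"
    using S assms by (simp add: aug_eq_sum[of _ ?S])
  finally show ?thesis .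
qed

lemma aug_single [simp]:
  assumes "a \<in> carrier A" "g \<in> carrier G"
  shows "aug (single a g) = a"
  using assms by (subst aug_eq_sum[of _ "{g}"]) (auto simp: supp_single)

lemma aug_zero [simp]: "aug \<zero>\<^bsub>AG\<^esub> = \<zero>\<^bsub>A\<^esub>"
  using aug_eq_sum[of "\<zero>\<^bsub>AG\<^esub>" "{}"] by (auto simp: supp_def)

lemma aug_one [simp]: "aug \<one>\<^bsub>AG\<^esub> = \<one>\<^bsub>A\<^esub>"
  by (simp add: one_eq_single)

lemma aug_minus [simp]:
  assumes "f \<in> carrier AG" "h \<in> carrier AG"
  shows "aug (f \<ominus>\<^bsub>AG\<^esub> h) = aug f \<ominus>\<^bsub>A\<^esub> aug h"
proof -
  have "(f \<ominus>\<^bsub>AG\<^esub> h) \<oplus>\<^bsub>AG\<^esub> h = f"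
    using assms by (simp add: a_minus_def AG.a_assoc AG.l_neg)
  then have "aug (f \<ominus>\<^bsub>AG\<^esub> h) \<oplus>\<^bsub>A\<^esub> aug h = aug f" using assms aug_add by (metis AG.minus_closed)
  then have "aug f \<ominus>\<^bsub>A\<^esub> aug h = (aug (f \<ominus>\<^bsub>AG\<^esub> h) \<oplus>\<^bsub>A\<^esub> aug h) \<ominus>\<^bsub>A\<^esub> aug h" by simp
  also have "\<dots> = aug (f \<ominus>\<^bsub>AG\<^esub> h)"
    using assms by (simp add: a_minus_def A.a_assoc A.r_neg del: aug_add)
  finally show ?thesis by simp
qed

lemma aug_single_mult:
  assumes a: "a \<in> carrier A" and g: "g \<in> carrier G" and f: "f \<in> carrier AG"
  shows "aug (single a g \<otimes>\<^bsub>AG\<^esub> f) = a \<otimes>\<^bsub>A\<^esub> aug f"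
proof -
  let ?S = "supp A G f"
  have S: "x \<in> ?S \<Longrightarrow> x \<in> carrier G" for x using supp_subset by auto
  let ?l = "\<lambda>x. g \<otimes>\<^bsub>G\<^esub> x"
  have sub: "supp A G (single a g \<otimes>\<^bsub>AG\<^esub> f) \<subseteq> ?l ` ?S"
  proof
    fix x assume x: "x \<in> supp A G (single a g \<otimes>\<^bsub>AG\<^esub> f)"
    then have xG: "x \<in> carrier G" by (simp add: supp_def)
    have "a \<otimes>\<^bsub>A\<^esub> f (inv\<^bsub>G\<^esub> g \<otimes>\<^bsub>G\<^esub> x) \<noteq> \<zero>\<^bsub>A\<^esub>" using x assms xG by (simp add: supp_def)
    then have "inv\<^bsub>G\<^esub> g \<otimes>\<^bsub>G\<^esub> x \<in> ?S" using a g xG by (auto simp: supp_def)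
    moreover have "x = ?l (inv\<^bsub>G\<^esub> g \<otimes>\<^bsub>G\<^esub> x)" using g xG by (simp add: G.m_assoc[symmetric])
    ultimately show "x \<in> ?l ` ?S" by blast
  qed
  have "aug (single a g \<otimes>\<^bsub>AG\<^esub> f) = (\<Oplus>\<^bsub>A\<^esub>x\<in>?l ` ?S. (single a g \<otimes>\<^bsub>AG\<^esub> f) x)"
    using assms sub S by (intro aug_eq_sum) auto
  also have "\<dots> = (\<Oplus>\<^bsub>A\<^esub>x\<in>?S. (single a g \<otimes>\<^bsub>AG\<^esub> f) (?l x))"
    using assms S by (intro A.add.finprod_reindex) (auto intro!: inj_onI)
  also have "\<dots> = (\<Oplus>\<^bsub>A\<^esub>x\<in>?S. a \<otimes>\<^bsub>A\<^esub> f x)"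
    using assms S by (intro A.finsum_cong') (auto simp: G.m_assoc[symmetric])
  also have "\<dots> = a \<otimes>\<^bsub>A\<^esub> aug f"
    unfolding aug_def using assms S by (intro A.finsum_rdistr[symmetric]) auto
  finally show ?thesis .
qed

text \<open>By additivity it is enough to multiply from the left by a monomial \<open>a \<cdot> g\<close>, which merely permutes the
  coefficients and multiplies them by \<open>a\<close>.\<close>
lemma aug_mult [simp]:
  assumes f: "f \<in> carrier AG" and h: "h \<in> carrier AG"
  shows "aug (f \<otimes>\<^bsub>AG\<^esub> h) = aug f \<otimes>\<^bsub>A\<^esub> aug h"
  using f
proof (induction rule: AG_induct)
  case zero
  then show ?case using h by simp
next
  case (single_add g k)
  then show ?case using f h by (simp add: AG.l_distr A.l_distr aug_single_mult)
qed

lemma aug_vimage_left_ideal: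
  assumes "left_ideal M A"
  shows "left_ideal {f \<in> carrier AG. aug f \<in> M} AG"
proof -
  interpret M: left_ideal M A by fact
  show ?thesis by (rule left_idealI) (auto simp: AG.ring_axioms M.I_l_closed)
qed

text \<open>The image under \<open>aug\<close> of a strictly larger left ideal \<open>J\<close> is a left ideal strictly larger than \<open>M\<close>, hence
  contains \<open>1 = aug j\<close> for some \<open>j \<in> J\<close>. As \<open>1 - j\<close> has augmentation \<open>0 \<in> M\<close>, it also lies in \<open>J\<close>, and
  so does \<open>1\<close>.\<close>
lemma aug_vimage_maximal_left_ideal:
  assumes "maximal_left_ideal M A"
  shows "maximal_left_ideal {f \<in> carrier AG. aug f \<in> M} AG"
proof -
  interpret M: maximal_left_ideal M A by fact
  let ?N = "{f \<in> carrier AG. aug f \<in> M}"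
  have "left_ideal ?N AG"
    by (rule aug_vimage_left_ideal) (rule M.left_ideal_axioms)
  then show ?thesis
  proof (rule maximal_left_ideal.intro, unfold_locales)
    have "\<one>\<^bsub>AG\<^esub> \<notin> ?N" using M.one_notin by simp
    then show "carrier AG \<noteq> ?N" using AG.one_closed by metis
    fix J assume J: "left_ideal J AG" "?N \<subseteq> J"
    interpret J: left_ideal J AG by fact
    have Jc: "f \<in> J \<Longrightarrow> f \<in> carrier AG" for f using J.a_subset by blast
    show "J = ?N \<or> J = carrier AG"
    proof (rule disjCI)
      assume "J \<noteq> carrier AG"
      show "J = ?N"
      proof (rule ccontr)
        assume "J \<noteq> ?N"
        then obtain f where f: "f \<in> J" "aug f \<notin> M" using J(2) Jc by blast
        have "left_ideal (aug ` J) A"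
        proof (rule left_idealI)
          show "\<zero>\<^bsub>A\<^esub> \<in> aug ` J" using J.zero_closed aug_zero by (metis image_eqI)
          show "x \<oplus>\<^bsub>A\<^esub> y \<in> aug ` J" if "x \<in> aug ` J" "y \<in> aug ` J" for x y
          proof -
            obtain i where i: "x = aug i" "i \<in> J" using \<open>x \<in> aug ` J\<close> by (rule imageE)
            obtain j where j: "y = aug j" "j \<in> J" using \<open>y \<in> aug ` J\<close> by (rule imageE)
            have "x \<oplus>\<^bsub>A\<^esub> y = aug (i \<oplus>\<^bsub>AG\<^esub> j)" using i j Jc by simp
            then show ?thesis using J.a_closed[OF i(2) j(2)] by (simp only: imageI)
          qed
          show "a \<otimes>\<^bsub>A\<^esub> x \<in> aug ` J" if "a \<in> carrier A" "x \<in> aug ` J" for a x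
          proof -
            obtain j where j: "x = aug j" "j \<in> J" using \<open>x \<in> aug ` J\<close> by (rule imageE)
            then have "a \<otimes>\<^bsub>A\<^esub> x = aug (single a \<one>\<^bsub>G\<^esub> \<otimes>\<^bsub>AG\<^esub> j)" using that Jc by simp
            then show ?thesis using J.I_l_closed[OF j(2)] that by (simp only: imageI single_closed)
          qed
        qed (use A.ring_axioms Jc in auto)
        moreover have "M \<subseteq> aug ` J"
        proof
          fix m assume m: "m \<in> M"
          then have "m \<in> carrier A" using M.a_subset by blast
          then have "aug (single m \<one>\<^bsub>G\<^esub>) = m" "single m \<one>\<^bsub>G\<^esub> \<in> ?N" using m by auto
          then show "m \<in> aug ` J" using J(2) by (metis (no_types, lifting) image_eqI subsetD)
        qed
        moreover have "aug ` J \<subseteq> carrier A" using Jc by auto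
        moreover have "aug ` J \<noteq> M" using f by blast
        ultimately have "aug ` J = carrier A" using M.I_maximal by metis
        then obtain j where j: "j \<in> J" "aug j = \<one>\<^bsub>A\<^esub>" using A.one_closed by (metis imageE)
        have "\<one>\<^bsub>AG\<^esub> \<ominus>\<^bsub>AG\<^esub> j \<in> J" using j Jc J(2) M.zero_closed by (auto simp: a_minus_def[of A] A.r_neg)
        then have "(\<one>\<^bsub>AG\<^esub> \<ominus>\<^bsub>AG\<^esub> j) \<oplus>\<^bsub>AG\<^esub> j \<in> J" using j by blast
        then have "\<one>\<^bsub>AG\<^esub> \<in> J" using Jc[OF j(1)] by (simp add: a_minus_def AG.a_assoc AG.l_neg)
        then show False using J.eq_carrier_if_one \<open>J \<noteq> carrier AG\<close> by blast
      qed
    qed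
  qed
qed

section \<open>Group rings that are local\<close>

text \<open>Two maximal left ideals of \<open>A\<close> have the same preimage under \<open>aug\<close>, and \<open>aug\<close> is surjective.\<close>
lemma local_ring_coefficients:
  assumes "local_ring AG" and "\<one>\<^bsub>A\<^esub> \<noteq> \<zero>\<^bsub>A\<^esub>"
  shows "local_ring A"
proof -
  have "left_ideal {\<zero>\<^bsub>A\<^esub>} A" by (rule left_idealI) (use A.ring_axioms in auto)
  then obtain M where M: "maximal_left_ideal M A"
    using A.exists_maximal_left_ideal assms(2) by blast
  have "M' = M" if M': "maximal_left_ideal M' A" for M'
  proof -
    have eq: "{f \<in> carrier AG. aug f \<in> M'} = {f \<in> carrier AG. aug f \<in> M}"
      using local_ring.unique_maximal_left_ideal[OF assms(1)] aug_vimage_maximal_left_ideal M M'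
      by blast
    have "a \<in> M' \<longleftrightarrow> a \<in> M" if a: "a \<in> carrier A" for a
    proof -
      have "single a \<one>\<^bsub>G\<^esub> \<in> {f \<in> carrier AG. aug f \<in> M'} \<longleftrightarrow> single a \<one>\<^bsub>G\<^esub> \<in> {f \<in> carrier AG. aug f \<in> M}"
        by (simp only: eq)
      then show ?thesis using a by simp
    qed
    moreover have "M \<subseteq> carrier A" "M' \<subseteq> carrier A"
      using M M' by (auto dest!: maximal_left_ideal.axioms(1) left_ideal.axioms(1) additive_subgroup.a_subset)
    ultimately show ?thesis by blast
  qed
  then show ?thesis
    using M A.ring_axioms by (auto simp: local_ring_def local_ring_axioms_def)
qed

text \<open>The values of \<open>y\<close> on the infinite cyclic group generated by \<open>g\<close> form a Laurent polynomial, and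
  multiplication by \<open>1 - g + g\<^sup>2\<close> becomes a recurrence for them. The product keeps the lowest term of \<open>y\<close>,
  and has its highest term two places above that of \<open>y\<close>. If the product is \<open>1\<close>, the lowest exponent is
  \<open>0\<close> and the highest is \<open>-2\<close>, which is absurd.\<close>
lemma trinomial_not_left_invertible:
  assumes g: "g \<in> carrier G" and ord: "group.ord G g = 0" and nz: "\<one>\<^bsub>A\<^esub> \<noteq> \<zero>\<^bsub>A\<^esub>"
    and y: "y \<in> carrier AG"
  shows "y \<otimes>\<^bsub>AG\<^esub> (single \<one>\<^bsub>A\<^esub> \<one>\<^bsub>G\<^esub> \<oplus>\<^bsub>AG\<^esub> single (\<ominus>\<^bsub>A\<^esub> \<one>\<^bsub>A\<^esub>) g \<oplus>\<^bsub>AG\<^esub> single \<one>\<^bsub>A\<^esub> (g \<otimes>\<^bsub>G\<^esub> g)) \<noteq> \<one>\<^bsub>AG\<^esub>"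
    (is "y \<otimes>\<^bsub>AG\<^esub> ?u \<noteq> _")
proof
  assume eq: "y \<otimes>\<^bsub>AG\<^esub> ?u = \<one>\<^bsub>AG\<^esub>"
  define Y where "Y n = y (g [^]\<^bsub>G\<^esub> n)" for n :: int
  have Yc: "Y n \<in> carrier A" for n using g y by (simp add: Y_def)
  have inj: "inj (\<lambda>n::int. g [^]\<^bsub>G\<^esub> n)"
    using g ord by (auto intro!: injI simp: G.int_pow_eq)
  have rec: "Y n \<oplus>\<^bsub>A\<^esub> \<ominus>\<^bsub>A\<^esub> Y (n - 1) \<oplus>\<^bsub>A\<^esub> Y (n - 2) = (if n = 0 then \<one>\<^bsub>A\<^esub> else \<zero>\<^bsub>A\<^esub>)" for n
  proof -
    let ?x = "g [^]\<^bsub>G\<^esub> n"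
    have x: "?x \<in> carrier G" using g by simp
    have 1: "?x \<otimes>\<^bsub>G\<^esub> inv\<^bsub>G\<^esub> g = g [^]\<^bsub>G\<^esub> (n - 1)"
      using g by (simp add: G.int_pow_diff)
    have "g [^]\<^bsub>G\<^esub> (2::int) = g \<otimes>\<^bsub>G\<^esub> g"
      using g G.int_pow_mult[of g 1 1] by simp
    then have 2: "?x \<otimes>\<^bsub>G\<^esub> inv\<^bsub>G\<^esub> (g \<otimes>\<^bsub>G\<^esub> g) = g [^]\<^bsub>G\<^esub> (n - 2)"
      using g by (simp add: G.int_pow_diff)
    have "(y \<otimes>\<^bsub>AG\<^esub> ?u) ?x = Y n \<oplus>\<^bsub>A\<^esub> \<ominus>\<^bsub>A\<^esub> Y (n - 1) \<oplus>\<^bsub>A\<^esub> Y (n - 2)"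
      using x g y Yc by (simp add: AG.r_distr 1 2 A.r_minus flip: Y_def)
    moreover have "g [^]\<^bsub>G\<^esub> n = \<one>\<^bsub>G\<^esub> \<longleftrightarrow> n = 0"
      using inj_eq[OF inj, of n 0] by simp
    then have "\<one>\<^bsub>AG\<^esub> ?x = (if n = 0 then \<one>\<^bsub>A\<^esub> else \<zero>\<^bsub>A\<^esub>)"
      using x by (simp add: one_eq_single)
    ultimately show ?thesis using eq by simp
  qed
  let ?Z = "{n. Y n \<noteq> \<zero>\<^bsub>A\<^esub>}"
  have "?Z = (\<lambda>n::int. g [^]\<^bsub>G\<^esub> n) -` supp A G y"
    using g by (auto simp: supp_def Y_def)
  then have fin: "finite ?Z" using finite_vimageI[OF _ inj] y by simp
  have ne: "?Z \<noteq> {}"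
  proof
    assume "?Z = {}"
    then have "Y n = \<zero>\<^bsub>A\<^esub>" for n by blast
    then show False using rec[of 0] nz by simp
  qed
  have "Max ?Z = -2"
  proof (rule ccontr)
    assume "Max ?Z \<noteq> -2"
    have "Y (Max ?Z + 2) = \<zero>\<^bsub>A\<^esub>" "Y (Max ?Z + 1) = \<zero>\<^bsub>A\<^esub>"
      using Max_ge[OF fin, of "Max ?Z + 2"] Max_ge[OF fin, of "Max ?Z + 1"] by auto
    then have "Y (Max ?Z) = \<zero>\<^bsub>A\<^esub>"
      using rec[of "Max ?Z + 2"] Yc \<open>Max ?Z \<noteq> -2\<close> by (simp add: add.commute)
    then show False using Max_in[OF fin ne] by simp
  qed
  moreover have "Min ?Z = 0"
  proof (rule ccontr)
    assume "Min ?Z \<noteq> 0"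
    have "Y (Min ?Z - 2) = \<zero>\<^bsub>A\<^esub>" "Y (Min ?Z - 1) = \<zero>\<^bsub>A\<^esub>"
      using Min_le[OF fin, of "Min ?Z - 2"] Min_le[OF fin, of "Min ?Z - 1"] by auto
    then have "Y (Min ?Z) = \<zero>\<^bsub>A\<^esub>"
      using rec[of "Min ?Z"] Yc \<open>Min ?Z \<noteq> 0\<close> by simp
    then show False using Min_in[OF fin ne] by simp
  qed
  ultimately show False using Min_le[OF fin Max_in[OF fin ne]] by simp
qed

lemma local_group_ring_finite_ord:
  assumes loc: "local_ring AG" and M: "maximal_left_ideal M A" and g: "g \<in> carrier G"
  shows "group.ord G g \<noteq> 0"
proof
  interpret M: maximal_left_ideal M A by fact
  assume ord: "group.ord G g = 0"
  let ?u = "single \<one>\<^bsub>A\<^esub> \<one>\<^bsub>G\<^esub> \<oplus>\<^bsub>AG\<^esub> single (\<ominus>\<^bsub>A\<^esub> \<one>\<^bsub>A\<^esub>) g \<oplus>\<^bsub>AG\<^esub> single \<one>\<^bsub>A\<^esub> (g \<otimes>\<^bsub>G\<^esub> g)"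
  have u: "?u \<in> carrier AG" by simp
  have "aug ?u = \<one>\<^bsub>A\<^esub>" using g by (simp add: A.r_neg)
  then have "aug ?u \<notin> M" using M.one_notin by simp
  then obtain y where "y \<in> carrier AG" "y \<otimes>\<^bsub>AG\<^esub> ?u = \<one>\<^bsub>AG\<^esub>"
    using local_ring_left_inverse[OF loc aug_vimage_maximal_left_ideal[OF M] u] by auto
  moreover have "\<one>\<^bsub>A\<^esub> \<noteq> \<zero>\<^bsub>A\<^esub>" using M.one_notin M.zero_closed by metis
  ultimately show False using trinomial_not_left_invertible[OF g ord] by blast
qed

text \<open>The sum \<open>s\<close> of all elements of the cyclic group generated by \<open>g\<close> has augmentation \<open>ord g\<close> and satisfies
  \<open>s g = s\<close>. If \<open>ord g\<close> were outside \<open>M\<close>, cancelling \<open>s\<close> would give \<open>g = 1\<close>.\<close>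
lemma local_group_ring_ord_in_maximal:
  assumes loc: "local_ring AG" and M: "maximal_left_ideal M A"
    and g: "g \<in> carrier G" "g \<noteq> \<one>\<^bsub>G\<^esub>"
  shows "add_pow A (group.ord G g) \<one>\<^bsub>A\<^esub> \<in> M"
proof (rule ccontr)
  interpret M: maximal_left_ideal M A by fact
  assume notin: "add_pow A (group.ord G g) \<one>\<^bsub>A\<^esub> \<notin> M"
  let ?C = "generate G {g}"
  interpret C: subgroup ?C G using g by (intro G.generate_is_subgroup) simp
  have card: "card ?C = group.ord G g" using g by (simp add: G.generate_pow_card)
  then have fin: "finite ?C"
    using local_group_ring_finite_ord[OF loc M g(1)] by (metis card.infinite)
  define s where "s = (\<lambda>x\<in>carrier G. if x \<in> ?C then \<one>\<^bsub>A\<^esub> else \<zero>\<^bsub>A\<^esub>)"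
  have s: "s \<in> carrier AG" unfolding s_def by (rule AG_memI[OF _ _ fin]) auto
  have sc: "s x = (if x \<in> ?C then \<one>\<^bsub>A\<^esub> else \<zero>\<^bsub>A\<^esub>)" if "x \<in> carrier G" for x
    using that by (simp add: s_def)
  have "aug s = (\<Oplus>\<^bsub>A\<^esub>x\<in>?C. s x)"
    by (rule aug_eq_sum[OF s fin]) (use sc in \<open>auto simp: supp_def split: if_splits\<close>)
  also have "\<dots> = (\<Oplus>\<^bsub>A\<^esub>x\<in>?C. \<one>\<^bsub>A\<^esub>)"
    by (rule A.finsum_cong') (auto simp: sc)
  also have "\<dots> = add_pow A (group.ord G g) \<one>\<^bsub>A\<^esub>"
    using A.add.finprod_const[of "\<one>\<^bsub>A\<^esub>" ?C] card by simp
  finally have "aug s \<notin> M" using notin by simp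
  then obtain y where y: "y \<in> carrier AG" "y \<otimes>\<^bsub>AG\<^esub> s = \<one>\<^bsub>AG\<^esub>"
    using local_ring_left_inverse[OF loc aug_vimage_maximal_left_ideal[OF M] s] by auto
  have gC: "g \<in> ?C" by (simp add: generate.incl)
  have "s \<otimes>\<^bsub>AG\<^esub> single \<one>\<^bsub>A\<^esub> g = s"
  proof (rule AG_eqI)
    fix x assume x: "x \<in> carrier G"
    have "x \<otimes>\<^bsub>G\<^esub> inv\<^bsub>G\<^esub> g \<in> ?C \<longleftrightarrow> x \<in> ?C"
      using gC x g by (metis C.m_closed C.m_inv_closed G.inv_closed G.inv_solve_right' G.m_closed)
    then show "(s \<otimes>\<^bsub>AG\<^esub> single \<one>\<^bsub>A\<^esub> g) x = s x" using s x g by (simp add: sc)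
  qed (use s in auto)
  then have "y \<otimes>\<^bsub>AG\<^esub> s \<otimes>\<^bsub>AG\<^esub> single \<one>\<^bsub>A\<^esub> g = y \<otimes>\<^bsub>AG\<^esub> s"
    using y(1) s by (simp add: AG.m_assoc)
  then have "single \<one>\<^bsub>A\<^esub> g = \<one>\<^bsub>AG\<^esub>" unfolding y(2) by simp
  then have "single \<one>\<^bsub>A\<^esub> g g = single \<one>\<^bsub>A\<^esub> \<one>\<^bsub>G\<^esub> g" by (simp only: one_eq_single)
  then have "\<one>\<^bsub>A\<^esub> = \<zero>\<^bsub>A\<^esub>" using g by simp
  then show False using M.one_notin M.zero_closed by metis
qed

text \<open>A prime \<open>q\<close> dividing the order of some element of \<open>G\<close> is itself the order of an element, so \<open>q \<in> M\<close>. Two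
  different primes cannot both lie in \<open>M\<close>, so the orders of all elements are powers of one prime.\<close>
lemma local_group_ring_imp_p_group:
  assumes loc: "local_ring AG" and M: "maximal_left_ideal M A"
    and "carrier G \<noteq> {\<one>\<^bsub>G\<^esub>}"
  shows "\<exists>p::nat. Factorial_Ring.prime p \<and> ring_char (A Quot M) = p \<and> p_group p G"
proof -
  interpret M: maximal_left_ideal M A by fact
  note ord0 = local_group_ring_finite_ord[OF loc M]
  have primeM: "add_pow A q \<one>\<^bsub>A\<^esub> \<in> M"
    if "x \<in> carrier G" "Factorial_Ring.prime q" "q dvd group.ord G x" for x q
    using G.exists_element_of_prime_ord[OF that(1) ord0[OF that(1)] that(2,3)]
      local_group_ring_ord_in_maximal[OF loc M] by metis
  obtain g where g: "g \<in> carrier G" "g \<noteq> \<one>\<^bsub>G\<^esub>" using assms(3) G.one_closed by blast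
  then have "group.ord G g \<noteq> 1" by (metis G.ord_eq_1 One_nat_def)
  then obtain p where p: "Factorial_Ring.prime p" "p dvd group.ord G g"
    using prime_factor_nat by blast
  have pM: "add_pow A p \<one>\<^bsub>A\<^esub> \<in> M" using primeM[OF g(1) p] .
  have "\<exists>k. group.ord G x = p ^ k" if x: "x \<in> carrier G" for x
  proof (rule power_if_only_prime_divisor[OF ord0[OF x]])
    fix q :: nat assume q: "Factorial_Ring.prime q" "q dvd group.ord G x"
    show "q = p"
    proof (rule ccontr)
      assume "q \<noteq> p"
      then have "coprime p q" using p(1) q(1) by (simp add: primes_coprime)
      then show False using M.one_in_if_coprime[OF _ pM primeM[OF x q]] M.one_notin by blast
    qed
  qed
  then have "p_group p G" using G.group_axioms by (simp add: p_group_def)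
  then show ?thesis using p(1) pM M.ring_char_Quot_eq_prime_iff by blast
qed

end

section \<open>Congruence modulo a left ideal\<close>

context left_ideal
begin

text \<open>Membership of \<open>x\<close> and \<open>y\<close> in the carrier is part of the relation, so that a chain of congruences
  carries its carrier conditions with it. The congruence classes are the cosets of \<open>I\<close>, which make
  up the left module \<open>R/I\<close>.\<close>
definition cong :: "'a \<Rightarrow> 'a \<Rightarrow> bool" where
  "cong x y \<longleftrightarrow> x \<in> carrier R \<and> y \<in> carrier R \<and> x \<ominus> y \<in> I"

lemma cong_iff_coset_eq:
  assumes "x \<in> carrier R" "y \<in> carrier R"
  shows "cong x y \<longleftrightarrow> I +> x = I +> y"
proof -
  interpret abelian_subgroup I R by (rule is_abelian_subgroup)
  have "x \<ominus> y \<in> I \<longleftrightarrow> x \<in> I +> y"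
    using a_rcos_module_minus[OF ring_axioms assms(2,1)] by simp
  also have "\<dots> \<longleftrightarrow> I +> x = I +> y"
    using assms a_repr_independence' a_repr_independenceD by metis
  finally show ?thesis using assms by (simp add: cong_def)
qed

lemma cong_refl: "x \<in> carrier R \<Longrightarrow> cong x x"
  by (simp add: cong_iff_coset_eq)

lemma cong_sym: "cong x y \<Longrightarrow> cong y x"
  by (metis cong_def cong_iff_coset_eq)

lemma cong_trans: "cong x y \<Longrightarrow> cong y z \<Longrightarrow> cong x z"
  by (metis cong_def cong_iff_coset_eq)

lemma cong_add:
  assumes "cong x y" "cong u v"
  shows "cong (x \<oplus> u) (y \<oplus> v)"
proof -
  have c: "x \<in> carrier R" "y \<in> carrier R" "u \<in> carrier R" "v \<in> carrier R"
    using assms by (auto simp: cong_def)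
  have "(x \<oplus> u) \<ominus> (y \<oplus> v) = (x \<ominus> y) \<oplus> (u \<ominus> v)"
    using c by (simp add: a_minus_def minus_add a_ac)
  then show ?thesis using assms c by (simp add: cong_def)
qed

lemma cong_l_mult:
  assumes "cong x y" "a \<in> carrier R"
  shows "cong (a \<otimes> x) (a \<otimes> y)"
proof -
  have c: "x \<in> carrier R" "y \<in> carrier R" using assms by (auto simp: cong_def)
  then have "a \<otimes> x \<ominus> a \<otimes> y = a \<otimes> (x \<ominus> y)"
    using assms by (simp add: a_minus_def r_distr r_minus)
  then show ?thesis using assms c I_l_closed by (simp add: cong_def)
qed

lemma cong_minus:
  assumes "cong x y" "z \<in> carrier R"
  shows "cong (x \<ominus> z) (y \<ominus> z)"
  unfolding a_minus_def using assms by (intro cong_add cong_refl) auto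

lemma cong_zero_iff: "cong x \<zero> \<longleftrightarrow> x \<in> I"
  using a_subset by (auto simp: cong_def a_minus_def)

lemma cong_mem: "cong x y \<Longrightarrow> y \<in> I \<Longrightarrow> x \<in> I"
  by (metis cong_trans cong_zero_iff)

text \<open>\<open>(q p) \<cdot> \<one>\<close> is the product of \<open>q \<cdot> \<one>\<close> and \<open>p \<cdot> \<one> \<in> I\<close>.\<close>
lemma add_pow_mult_mem:
  assumes "add_pow R (p::nat) \<one> \<in> I"
  shows "add_pow R (q * int p) \<one> \<in> I"
proof -
  have "add_pow R q \<one> \<otimes> add_pow R p \<one> = add_pow R q (add_pow R (int p) \<one>)"
    by (simp add: add_pow_ldistr_int add_pow_int_ge)
  also have "\<dots> = add_pow R (q * int p) \<one>"
    by (simp add: add.int_pow_pow mult.commute)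
  finally show ?thesis using I_l_closed[OF assms, of "add_pow R q \<one>"] by simp
qed

end

context ring_and_group
begin

section \<open>Maximal left ideals of the group ring of a finite p-group\<close>

text \<open>Nakayama's lemma for the \<open>A\<close>-module \<open>A[G]\<close>, which is generated by the group elements: if \<open>L\<close> and the
  elements with coefficients in \<open>M\<close> together span \<open>A[G]\<close>, then \<open>L\<close> already does. Generators are discarded
  one by one: the induction is on a finite set \<open>S\<close> such that every element is congruent modulo \<open>L\<close> to one
  supported in \<open>S\<close>. To discard \<open>s \<in> S\<close>, write \<open>s\<close> modulo \<open>L\<close> as a combination of the elements of \<open>S\<close> with
  coefficients in \<open>M\<close>. The coefficient \<open>a s\<close> of \<open>s\<close> in it can be moved to the other side, and \<open>1 - a s\<close> is
  left invertible because \<open>A\<close> is local, so \<open>s\<close> is a combination of the remaining generators.\<close>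
lemma nakayama_group_ring:
  assumes fin: "finite (carrier G)" and loc: "local_ring A" and M: "maximal_left_ideal M A"
    and L: "left_ideal L AG"
    and gen: "\<And>f. f \<in> carrier AG \<Longrightarrow>
      \<exists>m. (\<forall>x\<in>carrier G. m x \<in> M) \<and> left_ideal.cong L AG f m"
  shows "L = carrier AG"
proof -
  interpret M: maximal_left_ideal M A by fact
  interpret L: left_ideal L AG by fact
  have c1: "L.cong f h \<Longrightarrow> f \<in> carrier AG" and c2: "L.cong f h \<Longrightarrow> h \<in> carrier AG" for f h
    by (auto simp: L.cong_def)
  have "L = carrier AG"
    if "finite S" and
      "\<And>f. f \<in> carrier AG \<Longrightarrow> \<exists>b. (\<forall>x\<in>carrier G. x \<notin> S \<longrightarrow> b x = \<zero>\<^bsub>A\<^esub>) \<and> L.cong f b" for S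
    using that
  proof (induction S)
    case empty
    have "f \<in> L" if f: "f \<in> carrier AG" for f
    proof -
      obtain b where b: "\<forall>x\<in>carrier G. b x = \<zero>\<^bsub>A\<^esub>" "L.cong f b"
        using empty[OF f] by auto
      have "b = \<zero>\<^bsub>AG\<^esub>" using b c2 by (intro AG_eqI) auto
      then show ?thesis using b L.cong_zero_iff by simp
    qed
    then show ?case using L.a_subset by blast
  next
    case (insert s S)
    show ?case
    proof (cases "s \<in> carrier G")
      case False
      then show ?thesis using insert.IH insert.prems by (metis insert_iff)
    next
      case s: True
      \<comment> \<open>Modulo \<open>L\<close>, the coefficients of \<open>m\<close> can be moved into \<open>insert s S\<close> without leaving \<open>M\<close>; this uses that \<open>M\<close> is closed under multiplication from the right.\<close>
      have red: "\<exists>b. (\<forall>x\<in>carrier G. b x \<in> M \<and> (x \<notin> insert s S \<longrightarrow> b x = \<zero>\<^bsub>A\<^esub>)) \<and> L.cong m b"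
        if m: "m \<in> carrier AG" and mM: "\<forall>x\<in>carrier G. m x \<in> M" for m
        using m
      proof (induction rule: AG_induct)
        case zero
        show ?case by (rule exI[of _ "\<zero>\<^bsub>AG\<^esub>"]) (simp add: L.cong_refl)
      next
        case (single_add g h)
        then obtain b where b: "\<forall>x\<in>carrier G. b x \<in> M \<and> (x \<notin> insert s S \<longrightarrow> b x = \<zero>\<^bsub>A\<^esub>)" "L.cong h b"
          by blast
        obtain d where d: "\<forall>x\<in>carrier G. x \<notin> insert s S \<longrightarrow> d x = \<zero>\<^bsub>A\<^esub>" "L.cong (single \<one>\<^bsub>A\<^esub> g) d"
          using insert.prems[of "single \<one>\<^bsub>A\<^esub> g"] by auto
        have mg: "m g \<in> M" "m g \<in> carrier A" using mM m single_add by auto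
        let ?c = "single (m g) \<one>\<^bsub>G\<^esub>"
        have "?c \<otimes>\<^bsub>AG\<^esub> single \<one>\<^bsub>A\<^esub> g = single (m g) g"
          using mg single_add by (simp add: single_mult_single)
        then have "L.cong (single (m g) g \<oplus>\<^bsub>AG\<^esub> h) (?c \<otimes>\<^bsub>AG\<^esub> d \<oplus>\<^bsub>AG\<^esub> b)"
          using L.cong_add[OF L.cong_l_mult[OF d(2), of ?c] b(2)] mg by simp
        moreover have "(?c \<otimes>\<^bsub>AG\<^esub> d \<oplus>\<^bsub>AG\<^esub> b) x \<in> M \<and> (x \<notin> insert s S \<longrightarrow> (?c \<otimes>\<^bsub>AG\<^esub> d \<oplus>\<^bsub>AG\<^esub> b) x = \<zero>\<^bsub>A\<^esub>)"
          if x: "x \<in> carrier G" for x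
        proof -
          have "(?c \<otimes>\<^bsub>AG\<^esub> d \<oplus>\<^bsub>AG\<^esub> b) x = m g \<otimes>\<^bsub>A\<^esub> d x \<oplus>\<^bsub>A\<^esub> b x"
            using x mg c2[OF d(2)] by simp
          then show ?thesis
            using x b(1) d(1) mg local_ring_maximal_r_closed[OF loc M mg(1), of "d x"] c2[OF d(2)]
            by simp
        qed
        ultimately show ?case by blast
      qed
      obtain m where m: "\<forall>x\<in>carrier G. m x \<in> M" "L.cong (single \<one>\<^bsub>A\<^esub> s) m"
        using gen[of "single \<one>\<^bsub>A\<^esub> s"] by auto
      obtain a where a: "\<forall>x\<in>carrier G. a x \<in> M \<and> (x \<notin> insert s S \<longrightarrow> a x = \<zero>\<^bsub>A\<^esub>)" "L.cong m a"
        using red[OF c2[OF m(2)] m(1)] by blast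
      have ac: "a \<in> carrier AG" using c2[OF a(2)] .
      have as: "a s \<in> M" "a s \<in> carrier A" using a(1) s ac by auto
      have "\<one>\<^bsub>A\<^esub> \<ominus>\<^bsub>A\<^esub> a s \<notin> M"
      proof
        assume "\<one>\<^bsub>A\<^esub> \<ominus>\<^bsub>A\<^esub> a s \<in> M"
        then have "\<one>\<^bsub>A\<^esub> \<ominus>\<^bsub>A\<^esub> a s \<oplus>\<^bsub>A\<^esub> a s \<in> M"
          using as(1) additive_subgroup.a_closed[OF M.additive_subgroup_axioms] by blast
        then show False using as M.one_notin by (simp add: a_minus_def[of A] A.a_assoc A.l_neg)
      qed
      then obtain b where b: "b \<in> carrier A" "b \<otimes>\<^bsub>A\<^esub> (\<one>\<^bsub>A\<^esub> \<ominus>\<^bsub>A\<^esub> a s) = \<one>\<^bsub>A\<^esub>"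
        using local_ring_left_inverse[OF loc M A.minus_closed[OF A.one_closed as(2)]] by blast
      let ?a = "a \<ominus>\<^bsub>AG\<^esub> single (a s) s" and ?b = "single b \<one>\<^bsub>G\<^esub>"
      have "single \<one>\<^bsub>A\<^esub> s \<ominus>\<^bsub>AG\<^esub> single (a s) s = single (\<one>\<^bsub>A\<^esub> \<ominus>\<^bsub>A\<^esub> a s) s"
        using as by (intro AG_eqI) (auto simp: a_minus_def[of A])
      then have "L.cong (single (\<one>\<^bsub>A\<^esub> \<ominus>\<^bsub>A\<^esub> a s) s) ?a"
        using L.cong_minus[OF L.cong_trans[OF m(2) a(2)], of "single (a s) s"] as by simp
      from L.cong_l_mult[OF this, of ?b]
      have s_red: "L.cong (single \<one>\<^bsub>A\<^esub> s) (?b \<otimes>\<^bsub>AG\<^esub> ?a)"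
        using b as s by (simp add: single_mult_single)
      have "\<exists>b. (\<forall>x\<in>carrier G. x \<notin> S \<longrightarrow> b x = \<zero>\<^bsub>A\<^esub>) \<and> L.cong f b" if f: "f \<in> carrier AG" for f
      proof -
        obtain h where h: "\<forall>x\<in>carrier G. x \<notin> insert s S \<longrightarrow> h x = \<zero>\<^bsub>A\<^esub>" "L.cong f h"
          using insert.prems[OF f] by blast
        have hc: "h \<in> carrier AG" "h s \<in> carrier A" using c2[OF h(2)] s by auto
        let ?h = "h \<ominus>\<^bsub>AG\<^esub> single (h s) s" and ?c = "single (h s) \<one>\<^bsub>G\<^esub>"
        have "h = ?c \<otimes>\<^bsub>AG\<^esub> single \<one>\<^bsub>A\<^esub> s \<oplus>\<^bsub>AG\<^esub> ?h"
          using hc s by (simp add: single_mult_single a_minus_def AG.a_ac AG.r_neg)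
        moreover have "L.cong (?c \<otimes>\<^bsub>AG\<^esub> single \<one>\<^bsub>A\<^esub> s \<oplus>\<^bsub>AG\<^esub> ?h) (?c \<otimes>\<^bsub>AG\<^esub> (?b \<otimes>\<^bsub>AG\<^esub> ?a) \<oplus>\<^bsub>AG\<^esub> ?h)"
          using s_red hc by (intro L.cong_add L.cong_l_mult L.cong_refl) auto
        ultimately have "L.cong f (?c \<otimes>\<^bsub>AG\<^esub> (?b \<otimes>\<^bsub>AG\<^esub> ?a) \<oplus>\<^bsub>AG\<^esub> ?h)"
          using h(2) L.cong_trans by metis
        moreover have "(?c \<otimes>\<^bsub>AG\<^esub> (?b \<otimes>\<^bsub>AG\<^esub> ?a) \<oplus>\<^bsub>AG\<^esub> ?h) x = \<zero>\<^bsub>A\<^esub>"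
          if x: "x \<in> carrier G" "x \<notin> S" for x
          using x a(1) h(1) hc ac as b(1) s by (cases "x = s") (auto simp: a_minus_def[of A] A.r_neg)
        ultimately show ?thesis by blast
      qed
      then show ?thesis by (rule insert.IH)
    qed
  qed
  from this[OF fin] show ?thesis using L.cong_refl by blast
qed

text \<open>Since \<open>M\<close> is a left ideal, the elements congruent modulo \<open>L\<close> to one with coefficients in \<open>M\<close> form a left
  ideal. It contains \<open>L\<close>, and by Nakayama it is proper, so it equals \<open>L\<close>.\<close>
lemma coefficients_in_maximal_imp_mem:
  assumes fin: "finite (carrier G)" and loc: "local_ring A" and M: "maximal_left_ideal M A"
    and L: "maximal_left_ideal L AG"
    and f: "f \<in> carrier AG" "\<forall>x\<in>carrier G. f x \<in> M"
  shows "f \<in> L"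
proof (rule ccontr)
  assume fL: "f \<notin> L"
  interpret M: maximal_left_ideal M A by fact
  interpret L: maximal_left_ideal L AG by fact
  let ?J = "{h. \<exists>m. (\<forall>x\<in>carrier G. m x \<in> M) \<and> L.cong h m}"
  have "left_ideal ?J AG"
  proof (rule left_idealI)
    show "?J \<subseteq> carrier AG" by (auto simp: L.cong_def)
    have "L.cong \<zero>\<^bsub>AG\<^esub> \<zero>\<^bsub>AG\<^esub>" by (simp add: L.cong_refl)
    moreover have "\<forall>x\<in>carrier G. \<zero>\<^bsub>AG\<^esub> x \<in> M" by simp
    ultimately show "\<zero>\<^bsub>AG\<^esub> \<in> ?J" by blast
    show "u \<oplus>\<^bsub>AG\<^esub> v \<in> ?J" if uv: "u \<in> ?J" "v \<in> ?J" for u v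
    proof -
      obtain m n where "\<forall>x\<in>carrier G. m x \<in> M" "L.cong u m" "\<forall>x\<in>carrier G. n x \<in> M" "L.cong v n"
        using uv by blast
      moreover from this have "\<forall>x\<in>carrier G. (m \<oplus>\<^bsub>AG\<^esub> n) x \<in> M" by simp
      ultimately show ?thesis using L.cong_add by blast
    qed
    show "a \<otimes>\<^bsub>AG\<^esub> u \<in> ?J" if a: "a \<in> carrier AG" and u: "u \<in> ?J" for a u
    proof -
      obtain m where m: "\<forall>x\<in>carrier G. m x \<in> M" "L.cong u m" using u by blast
      have mc: "m \<in> carrier AG" using m by (simp add: L.cong_def)
      have "\<forall>x\<in>carrier G. (a \<otimes>\<^bsub>AG\<^esub> m) x \<in> M"
        using a
      proof (induction rule: AG_induct)
        case (single_add g h)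
        then show ?case using mc m(1) a by (simp add: AG.l_distr M.I_l_closed)
      qed (use mc in simp)
      then show ?thesis using L.cong_l_mult[OF m(2) a] by blast
    qed
  qed (rule AG.ring_axioms)
  moreover have "L \<subseteq> ?J"
  proof
    fix l assume "l \<in> L"
    then have "L.cong l \<zero>\<^bsub>AG\<^esub>" by (simp add: L.cong_zero_iff)
    moreover have "\<forall>x\<in>carrier G. \<zero>\<^bsub>AG\<^esub> x \<in> M" by simp
    ultimately show "l \<in> ?J" by blast
  qed
  moreover have "f \<in> ?J" using f L.cong_refl by blast
  moreover have "?J \<subseteq> carrier AG" by (auto simp: L.cong_def)
  ultimately have "?J = carrier AG" using L.I_maximal[of ?J] fL by blast
  then have "L = carrier AG"
    by (intro nakayama_group_ring[OF fin loc M L.left_ideal_axioms]) blast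
  then show False using L.I_notcarr by simp
qed

text \<open>Let \<open>F\<close> consist of the elements whose coefficients are integer multiples of \<open>\<one>\<close>, and \<open>W\<close> of the cosets
  that they represent modulo \<open>L\<close>. Integers matter only modulo \<open>p\<close>, because \<open>L\<close> contains the elements with
  coefficients in \<open>M\<close>; so \<open>W\<close> is a finite group under addition, killed by \<open>p\<close>. It contains the nonzero
  coset of \<open>\<one>\<close>, which has order \<open>p\<close>, whence \<open>p\<close> divides the size of \<open>W\<close>. The \<open>p\<close>-group \<open>G\<close> acts on \<open>W\<close> from
  the left and fixes the zero coset, so it fixes another coset as well.\<close>
lemma exists_fixed_vector_mod:
  assumes fin: "finite (carrier G)" and p: "Factorial_Ring.prime p" and pG: "p_group p G"
    and M: "left_ideal M A" "add_pow A (p::nat) \<one>\<^bsub>A\<^esub> \<in> M"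
    and L: "left_ideal L AG" "\<one>\<^bsub>AG\<^esub> \<notin> L"
    and coeff: "\<And>f. f \<in> carrier AG \<Longrightarrow> \<forall>x\<in>carrier G. f x \<in> M \<Longrightarrow> f \<in> L"
  shows "\<exists>w. w \<notin> L \<and> (\<forall>h\<in>carrier G. left_ideal.cong L AG (single \<one>\<^bsub>A\<^esub> h \<otimes>\<^bsub>AG\<^esub> w) w)"
proof -
  interpret M: left_ideal M A by fact
  interpret L: left_ideal L AG by fact
  interpret LS: abelian_subgroup L AG by (rule L.is_abelian_subgroup)
  define F where "F = {f \<in> carrier AG. \<forall>x\<in>carrier G. \<exists>n::int. f x = add_pow A n \<one>\<^bsub>A\<^esub>}"
  define W where "W = (\<lambda>f. L +>\<^bsub>AG\<^esub> f) ` F"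
  have FC: "f \<in> carrier AG" if "f \<in> F" for f using that by (simp add: F_def)
  have int_zero: "\<exists>n::int. \<zero>\<^bsub>A\<^esub> = add_pow A n \<one>\<^bsub>A\<^esub>"
    by (rule exI[of _ 0]) (simp add: add_pow_def)
  have int_one: "\<exists>n::int. \<one>\<^bsub>A\<^esub> = add_pow A n \<one>\<^bsub>A\<^esub>"
    by (rule exI[of _ 1]) (use A.add.int_pow_1[of "\<one>\<^bsub>A\<^esub>"] in simp)
  have F_group: "subgroup F (add_monoid AG)"
  proof (rule group.subgroupI[OF AG.add.is_group])
    show "F \<noteq> {}" using int_zero by (auto simp: F_def intro!: exI[of _ "\<zero>\<^bsub>AG\<^esub>"])
    fix f assume f: "f \<in> F"
    have "\<exists>n::int. (\<ominus>\<^bsub>AG\<^esub> f) x = add_pow A n \<one>\<^bsub>A\<^esub>" if x: "x \<in> carrier G" for x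
    proof -
      obtain n :: int where n: "f x = add_pow A n \<one>\<^bsub>A\<^esub>" using f x by (auto simp: F_def)
      have "(\<ominus>\<^bsub>AG\<^esub> f) x = (\<zero>\<^bsub>AG\<^esub> \<ominus>\<^bsub>AG\<^esub> f) x" using FC[OF f] by (simp add: a_minus_def[of AG])
      also have "\<dots> = \<ominus>\<^bsub>A\<^esub> f x"
        using FC[OF f] x by (simp only: minus_coeff[OF AG.zero_closed] zero_coeff) (simp add: a_minus_def)
      also have "\<dots> = add_pow A (- n) \<one>\<^bsub>A\<^esub>" by (simp add: n A.add.int_pow_neg)
      finally show ?thesis by blast
    qed
    then have "\<ominus>\<^bsub>AG\<^esub> f \<in> F" using FC[OF f] by (simp add: F_def)
    then show "inv\<^bsub>add_monoid AG\<^esub> f \<in> F" by (simp only: a_inv_def)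
    fix h assume h: "h \<in> F"
    have "\<exists>n::int. (f \<oplus>\<^bsub>AG\<^esub> h) x = add_pow A n \<one>\<^bsub>A\<^esub>" if x: "x \<in> carrier G" for x
    proof -
      obtain n :: int where n: "f x = add_pow A n \<one>\<^bsub>A\<^esub>" using f x by (auto simp: F_def)
      obtain k :: int where "h x = add_pow A k \<one>\<^bsub>A\<^esub>" using h x by (auto simp: F_def)
      with n have "(f \<oplus>\<^bsub>AG\<^esub> h) x = add_pow A (n + k) \<one>\<^bsub>A\<^esub>" using x by (simp add: A.add.int_pow_mult)
      then show ?thesis by blast
    qed
    then show "f \<otimes>\<^bsub>add_monoid AG\<^esub> h \<in> F" using FC[OF f] FC[OF h] by (simp add: F_def)
  qed (auto simp: F_def)
  have oneF: "\<one>\<^bsub>AG\<^esub> \<in> F" using int_one int_zero by (simp add: F_def one_eq_single)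
  interpret Q: group "AG A_Mod L" by (rule LS.a_factorgroup_is_group)
  interpret q: group_hom "add_monoid AG" "AG A_Mod L" "\<lambda>f. L +>\<^bsub>AG\<^esub> f"
    using LS.a_r_coset_hom_A_Mod AG.add.is_group Q.group_axioms
    by (simp add: group_hom_def group_hom_axioms_def)
  have W_group: "subgroup W (AG A_Mod L)"
    unfolding W_def by (rule q.subgroup_img_is_subgroup[OF F_group])
  have oneQ: "\<one>\<^bsub>AG A_Mod L\<^esub> = L" by (simp add: A_FactGroup_def FactGroup_def)
  have coset0: "L +>\<^bsub>AG\<^esub> f = L \<longleftrightarrow> f \<in> L" if f: "f \<in> carrier AG" for f
    using L.cong_iff_coset_eq[OF f AG.zero_closed] L.cong_zero_iff[of f] L.a_subset by simp
  have finW: "finite W"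
  proof (rule finite_subset)
    let ?R = "carrier G \<rightarrow>\<^sub>E (\<lambda>k::nat. add_pow A k \<one>\<^bsub>A\<^esub>) ` {..<p}"
    show "finite ((\<lambda>f. L +>\<^bsub>AG\<^esub> f) ` ?R)" using fin by (intro finite_imageI finite_PiE) auto
    show "W \<subseteq> (\<lambda>f. L +>\<^bsub>AG\<^esub> f) ` ?R"
    proof
      fix C assume "C \<in> W"
      then obtain f where f: "f \<in> F" "C = L +>\<^bsub>AG\<^esub> f" by (auto simp: W_def)
      have "\<forall>x\<in>carrier G. \<exists>n::int. f x = add_pow A n \<one>\<^bsub>A\<^esub>" using f by (simp add: F_def)
      then obtain n :: "'g \<Rightarrow> int" where n: "\<And>x. x \<in> carrier G \<Longrightarrow> f x = add_pow A (n x) \<one>\<^bsub>A\<^esub>"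
        by metis
      \<comment> \<open>\<open>r\<close> is \<open>f\<close> with its integer coefficients reduced modulo \<open>p\<close>; there are finitely many such \<open>r\<close>.\<close>
      define r where "r = (\<lambda>x\<in>carrier G. add_pow A (nat (n x mod int p)) \<one>\<^bsub>A\<^esub>)"
      have p0: "int p > 0" using prime_gt_0_nat[OF p] by simp
      have "nat (n x mod int p) < p" for x
        using pos_mod_bound[OF p0, of "n x"] pos_mod_sign[OF p0, of "n x"] by linarith
      then have rR: "r \<in> ?R" by (auto simp: r_def)
      have rC: "r \<in> carrier AG" by (rule AG_memI[OF _ _ fin]) (auto simp: r_def)
      have "(f \<ominus>\<^bsub>AG\<^esub> r) x \<in> M" if x: "x \<in> carrier G" for x
      proof -
        have "r x = add_pow A (n x mod int p) \<one>\<^bsub>A\<^esub>"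
          using x pos_mod_sign[OF p0, of "n x"] by (simp add: r_def add_pow_int_ge)
        then have "(f \<ominus>\<^bsub>AG\<^esub> r) x = add_pow A (n x - n x mod int p) \<one>\<^bsub>A\<^esub>"
          using x FC[OF f(1)] rC n[OF x] by (simp add: A.add.int_pow_diff a_minus_def[of A])
        also have "n x - n x mod int p = (n x div int p) * int p"
          by (simp add: minus_mod_eq_div_mult)
        finally show ?thesis using M.add_pow_mult_mem[OF M(2)] by simp
      qed
      then have "f \<ominus>\<^bsub>AG\<^esub> r \<in> L" using coeff FC[OF f(1)] rC by simp
      then have "C = L +>\<^bsub>AG\<^esub> r"
        using L.cong_iff_coset_eq FC[OF f(1)] rC f(2) by (simp add: L.cong_def)
      then show "C \<in> (\<lambda>f. L +>\<^bsub>AG\<^esub> f) ` ?R" using rR by blast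
    qed
  qed
  have dvd: "p dvd card W"
  proof -
    interpret W: group "(AG A_Mod L)\<lparr>carrier := W\<rparr>"
      using subgroup.subgroup_is_group[OF W_group Q.group_axioms] .
    let ?u = "L +>\<^bsub>AG\<^esub> \<one>\<^bsub>AG\<^esub>"
    have "add_pow AG p \<one>\<^bsub>AG\<^esub> \<in> L"
    proof (rule coeff)
      have "add_pow AG k \<one>\<^bsub>AG\<^esub> = single (add_pow A k \<one>\<^bsub>A\<^esub>) \<one>\<^bsub>G\<^esub>" for k :: nat
        by (induction k) (auto intro!: AG_eqI simp: one_eq_single)
      then show "\<forall>x\<in>carrier G. add_pow AG p \<one>\<^bsub>AG\<^esub> x \<in> M" using M(2) by simp
    qed simp
    then have "L +>\<^bsub>AG\<^esub> (\<one>\<^bsub>AG\<^esub> [^]\<^bsub>add_monoid AG\<^esub> p) = L"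
      using coset0[of "add_pow AG p \<one>\<^bsub>AG\<^esub>"] by (simp add: add_pow_def)
    then have "?u [^]\<^bsub>AG A_Mod L\<^esub> p = L"
      using q.hom_nat_pow[of "\<one>\<^bsub>AG\<^esub>" p] by simp
    then have "?u [^]\<^bsub>(AG A_Mod L)\<lparr>carrier := W\<rparr>\<^esub> p = L"
      by (metis Q.nat_pow_consistent)
    moreover have "?u \<noteq> L" using coset0[OF AG.one_closed] L(2) by simp
    moreover have "?u \<in> W" using oneF by (auto simp: W_def)
    ultimately have "W.ord ?u = p" using W.ord_eq_prime[OF _ _ p, of ?u] oneQ by simp
    then show ?thesis using W.ord_dvd_group_order[of ?u] \<open>?u \<in> W\<close> by (simp add: order_def)
  qed
  \<comment> \<open>\<open>G\<close> acts on a coset through an arbitrary representative; the choice is immaterial because \<open>L\<close> is a left ideal.\<close>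
  define act where "act h C = L +>\<^bsub>AG\<^esub> (single \<one>\<^bsub>A\<^esub> h \<otimes>\<^bsub>AG\<^esub> (SOME f. f \<in> carrier AG \<and> L +>\<^bsub>AG\<^esub> f = C))" for h C
  have act: "act h (L +>\<^bsub>AG\<^esub> f) = L +>\<^bsub>AG\<^esub> (single \<one>\<^bsub>A\<^esub> h \<otimes>\<^bsub>AG\<^esub> f)"
    if f: "f \<in> carrier AG" for h f
  proof -
    let ?f = "SOME f'. f' \<in> carrier AG \<and> L +>\<^bsub>AG\<^esub> f' = L +>\<^bsub>AG\<^esub> f"
    have f': "?f \<in> carrier AG \<and> L +>\<^bsub>AG\<^esub> ?f = L +>\<^bsub>AG\<^esub> f"
      by (rule someI[of _ f]) (use f in simp)
    then have "L.cong ?f f" using f by (simp add: L.cong_iff_coset_eq)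
    from L.cong_l_mult[OF this, of "single \<one>\<^bsub>A\<^esub> h"]
    show ?thesis unfolding act_def using f f' by (simp add: L.cong_iff_coset_eq)
  qed
  have action: "group_action G W (\<lambda>h. \<lambda>C\<in>W. act h C)"
  proof (rule group_actionI)
    fix C assume "C \<in> W"
    then obtain f where f: "f \<in> F" "C = L +>\<^bsub>AG\<^esub> f" by (auto simp: W_def)
    note fC = FC[OF f(1)]
    show "act \<one>\<^bsub>G\<^esub> C = C" using fC by (simp add: f(2) act flip: one_eq_single)
    fix g assume g: "g \<in> carrier G"
    have "single \<one>\<^bsub>A\<^esub> g \<otimes>\<^bsub>AG\<^esub> f \<in> F" using f(1) g by (auto simp: F_def)
    then show "act g C \<in> W" using fC by (auto simp: f(2) act W_def)
    fix h assume h: "h \<in> carrier G"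
    have "single \<one>\<^bsub>A\<^esub> (g \<otimes>\<^bsub>G\<^esub> h) = single \<one>\<^bsub>A\<^esub> g \<otimes>\<^bsub>AG\<^esub> single \<one>\<^bsub>A\<^esub> h"
      using g h by (simp add: single_mult_single)
    then show "act (g \<otimes>\<^bsub>G\<^esub> h) C = act g (act h C)"
      using fC by (simp add: f(2) act AG.m_assoc)
  qed (rule G.group_axioms)
  obtain n where ord: "order G = p ^ n" using finite_p_group_order[OF pG p fin] by blast
  have LW: "L \<in> W" using subgroup.one_closed[OF W_group] oneQ by simp
  have fixL: "(\<lambda>C\<in>W. act h C) L = L" if "h \<in> carrier G" for h
    using LW act[OF AG.zero_closed, of h] coset0[OF AG.zero_closed] by simp
  obtain C where C: "C \<in> W" "C \<noteq> L" "\<forall>h\<in>carrier G. (\<lambda>C\<in>W. act h C) C = C"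
    using group_action.fixed_point_p_group[OF action p ord finW dvd LW fixL] by metis
  obtain w where w: "w \<in> F" "C = L +>\<^bsub>AG\<^esub> w" using C(1) by (auto simp: W_def)
  have "w \<notin> L" using C(2) w(2) coset0[OF FC[OF w(1)]] by simp
  moreover have "L.cong (single \<one>\<^bsub>A\<^esub> h \<otimes>\<^bsub>AG\<^esub> w) w" if "h \<in> carrier G" for h
    using C(1,3) that w FC[OF w(1)] act by (simp add: L.cong_iff_coset_eq)
  ultimately show ?thesis by meson
qed

text \<open>Let \<open>x\<close> be fixed by \<open>G\<close> modulo \<open>L\<close>. Then \<open>c k x\<close> is congruent to \<open>c x\<close> for all \<open>k \<in> carrier G\<close> and all
  coefficients \<open>c\<close>. Taking \<open>k = g\<close> and \<open>k = h g\<close> shows that \<open>h\<close> fixes \<open>c g x\<close>.\<close>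
lemma fixed_vectors_left_ideal:
  assumes "left_ideal L AG"
  shows "left_ideal {x. \<forall>h\<in>carrier G. left_ideal.cong L AG (single \<one>\<^bsub>A\<^esub> h \<otimes>\<^bsub>AG\<^esub> x) x} AG"
    (is "left_ideal ?T AG")
proof -
  interpret L: left_ideal L AG by fact
  have TC: "x \<in> carrier AG" if "x \<in> ?T" for x
    using that G.one_closed by (auto simp: L.cong_def)
  have add: "x \<oplus>\<^bsub>AG\<^esub> y \<in> ?T" if "x \<in> ?T" "y \<in> ?T" for x y
    using that TC[OF that(1)] TC[OF that(2)] by (simp add: AG.r_distr L.cong_add)
  have zero: "\<zero>\<^bsub>AG\<^esub> \<in> ?T" by (simp add: L.cong_refl)
  have mult: "single c g \<otimes>\<^bsub>AG\<^esub> x \<in> ?T" if c: "c \<in> carrier A" and g: "g \<in> carrier G" and x: "x \<in> ?T" for c g x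
  proof -
    note xC = TC[OF x]
    have red: "L.cong (single c k \<otimes>\<^bsub>AG\<^esub> x) (single c \<one>\<^bsub>G\<^esub> \<otimes>\<^bsub>AG\<^esub> x)" if k: "k \<in> carrier G" for k
    proof -
      have "L.cong (single \<one>\<^bsub>A\<^esub> k \<otimes>\<^bsub>AG\<^esub> x) x" using x k by blast
      from L.cong_l_mult[OF this, of "single c \<one>\<^bsub>G\<^esub>"] show ?thesis
        using c k xC by (simp add: single_mult_single flip: AG.m_assoc)
    qed
    have "L.cong (single \<one>\<^bsub>A\<^esub> h \<otimes>\<^bsub>AG\<^esub> (single c g \<otimes>\<^bsub>AG\<^esub> x)) (single c g \<otimes>\<^bsub>AG\<^esub> x)"
      if h: "h \<in> carrier G" for h
    proof -
      have "single \<one>\<^bsub>A\<^esub> h \<otimes>\<^bsub>AG\<^esub> (single c g \<otimes>\<^bsub>AG\<^esub> x) = single c (h \<otimes>\<^bsub>G\<^esub> g) \<otimes>\<^bsub>AG\<^esub> x"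
        using c g h xC by (simp add: single_mult_single flip: AG.m_assoc)
      then show ?thesis
        using L.cong_trans[OF red[of "h \<otimes>\<^bsub>G\<^esub> g"] L.cong_sym[OF red[OF g]]] g h by simp
    qed
    then show ?thesis by blast
  qed
  show ?thesis
  proof (rule left_idealI)
    show "a \<otimes>\<^bsub>AG\<^esub> x \<in> ?T" if a: "a \<in> carrier AG" and x: "x \<in> ?T" for a x
      using a
    proof (induction rule: AG_induct)
      case zero
      then show ?case using TC[OF x] by (simp add: L.cong_refl)
    next
      case (single_add g h)
      have "single (a g) g \<otimes>\<^bsub>AG\<^esub> x \<oplus>\<^bsub>AG\<^esub> h \<otimes>\<^bsub>AG\<^esub> x \<in> ?T"
        by (rule add[OF mult single_add(3)]) (use a single_add x in auto)
      then show ?case using single_add a TC[OF x] by (simp only: AG.l_distr single_closed coeff_closed)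
    qed
    show "?T \<subseteq> carrier AG" using TC by blast
    show "x \<oplus>\<^bsub>AG\<^esub> y \<in> ?T" if "x \<in> ?T" "y \<in> ?T" for x y using add that .
    show "\<zero>\<^bsub>AG\<^esub> \<in> ?T" by (rule zero)
  qed (rule AG.ring_axioms)
qed

lemma cong_aug:
  assumes L: "left_ideal L AG"
    and triv: "\<And>h. h \<in> carrier G \<Longrightarrow> left_ideal.cong L AG (single \<one>\<^bsub>A\<^esub> h) \<one>\<^bsub>AG\<^esub>"
    and f: "f \<in> carrier AG"
  shows "left_ideal.cong L AG f (single (aug f) \<one>\<^bsub>G\<^esub>)"
  using f
proof (induction rule: AG_induct)
  interpret L: left_ideal L AG by fact
  case zero
  have "single \<zero>\<^bsub>A\<^esub> \<one>\<^bsub>G\<^esub> = \<zero>\<^bsub>AG\<^esub>" by (rule AG_eqI) auto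
  then show ?case by (simp add: L.cong_refl)
next
  interpret L: left_ideal L AG by fact
  case (single_add g h)
  have fg: "f g \<in> carrier A" using f single_add by simp
  have "single (f g) \<one>\<^bsub>G\<^esub> \<otimes>\<^bsub>AG\<^esub> single \<one>\<^bsub>A\<^esub> g = single (f g) g"
    using fg single_add by (simp add: single_mult_single)
  then have "L.cong (single (f g) g) (single (f g) \<one>\<^bsub>G\<^esub>)"
    using L.cong_l_mult[OF triv[of g], of "single (f g) \<one>\<^bsub>G\<^esub>"] fg single_add by simp
  then have "L.cong (single (f g) g \<oplus>\<^bsub>AG\<^esub> h) (single (f g) \<one>\<^bsub>G\<^esub> \<oplus>\<^bsub>AG\<^esub> single (aug h) \<one>\<^bsub>G\<^esub>)"
    using single_add by (intro L.cong_add)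
  moreover have "single (f g) \<one>\<^bsub>G\<^esub> \<oplus>\<^bsub>AG\<^esub> single (aug h) \<one>\<^bsub>G\<^esub> = single (aug (single (f g) g \<oplus>\<^bsub>AG\<^esub> h)) \<one>\<^bsub>G\<^esub>"
    using fg single_add by (intro AG_eqI) auto
  ultimately show ?case by simp
qed

text \<open>The fixed vectors modulo \<open>L\<close> form a left ideal that contains \<open>L\<close> strictly, hence everything, in
  particular \<open>\<one>\<close>. So each \<open>h \<in> carrier G\<close> is congruent to \<open>\<one>\<close> modulo \<open>L\<close>, and each element to its
  augmentation. Thus \<open>L\<close> contains the preimage of \<open>M\<close>, which is maximal.\<close>
lemma finite_p_group_maximal_left_ideal:
  assumes fin: "finite (carrier G)" and p: "Factorial_Ring.prime p" and pG: "p_group p G"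
    and loc: "local_ring A" and M: "maximal_left_ideal M A" "add_pow A (p::nat) \<one>\<^bsub>A\<^esub> \<in> M"
    and L: "maximal_left_ideal L AG"
  shows "L = {f \<in> carrier AG. aug f \<in> M}"
proof -
  interpret M: maximal_left_ideal M A by fact
  interpret L: maximal_left_ideal L AG by fact
  note coeff = coefficients_in_maximal_imp_mem[OF fin loc M(1) L]
  let ?T = "{x. \<forall>h\<in>carrier G. L.cong (single \<one>\<^bsub>A\<^esub> h \<otimes>\<^bsub>AG\<^esub> x) x}"
  have T: "left_ideal ?T AG" by (rule fixed_vectors_left_ideal[OF L.left_ideal_axioms])
  have TC: "?T \<subseteq> carrier AG" using G.one_closed by (auto simp: L.cong_def)
  have "L \<subseteq> ?T"
  proof
    fix l assume l: "l \<in> L"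
    have "L.cong (single \<one>\<^bsub>A\<^esub> h \<otimes>\<^bsub>AG\<^esub> l) l" for h
      using L.I_l_closed[OF l, of "single \<one>\<^bsub>A\<^esub> h"] l L.cong_zero_iff L.cong_trans L.cong_sym
      by (metis A.one_closed single_closed)
    then show "l \<in> ?T" by blast
  qed
  moreover obtain w where "w \<notin> L" "w \<in> ?T"
    using exists_fixed_vector_mod[OF fin p pG M.left_ideal_axioms M(2) L.left_ideal_axioms L.one_notin coeff]
    by blast
  ultimately have "?T = carrier AG" using L.I_maximal[OF T _ TC] by blast
  then have "\<one>\<^bsub>AG\<^esub> \<in> ?T" using AG.one_closed by blast
  then have triv: "L.cong (single \<one>\<^bsub>A\<^esub> h) \<one>\<^bsub>AG\<^esub>" if "h \<in> carrier G" for h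
    using that by simp
  have "f \<in> L" if f: "f \<in> carrier AG" "aug f \<in> M" for f
  proof -
    have "single (aug f) \<one>\<^bsub>G\<^esub> \<in> L" using f coeff by simp
    then show ?thesis using cong_aug[OF L.left_ideal_axioms triv f(1)] L.cong_mem by blast
  qed
  then have "{f \<in> carrier AG. aug f \<in> M} \<subseteq> L" by blast
  then show ?thesis
    using maximal_left_ideal.I_maximal[OF aug_vimage_maximal_left_ideal[OF M(1)] L.left_ideal_axioms _ L.a_subset]
      L.I_notcarr by metis
qed

end

section \<open>Group rings of locally finite p-groups\<close>

lemma p_group_subgroup:
  assumes "p_group p G" "subgroup H G"
  shows "p_group p (G\<lparr>carrier := H\<rparr>)"
proof -
  interpret group G using assms(1) by (simp add: p_group_def)
  interpret H: group "G\<lparr>carrier := H\<rparr>"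
    using subgroup.subgroup_is_group[OF assms(2) group_axioms] .
  have "H.ord x = ord x" for x
    unfolding group.ord_def[OF group_axioms] H.ord_def using nat_pow_consistent[of x _ H] by simp
  then show ?thesis
    using assms subgroup.subset[OF assms(2)] H.group_axioms by (auto simp: p_group_def)
qed

context ring_and_group
begin

text \<open>Extending a function on \<open>H\<close> by zero embeds \<open>A[H]\<close> into \<open>A[G]\<close>. In the product of the extension of \<open>y\<close> with
  \<open>f\<close>, the coefficient at \<open>x \<in> H\<close> is the one computed in \<open>A[H]\<close>, and for \<open>x \<notin> H\<close> all elements
  \<open>inv h \<otimes> x\<close> with \<open>h \<in> H\<close> lie outside \<open>H\<close>, where \<open>f\<close> vanishes.\<close>
lemma left_inverse_from_subgroup:
  assumes H: "subgroup H G" and f: "f \<in> carrier AG" "supp A G f \<subseteq> H"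
    and y: "y \<in> carrier (group_ring A (G\<lparr>carrier := H\<rparr>))"
    and yf: "y \<otimes>\<^bsub>group_ring A (G\<lparr>carrier := H\<rparr>)\<^esub> restrict f H = \<one>\<^bsub>group_ring A (G\<lparr>carrier := H\<rparr>)\<^esub>"
  shows "\<exists>z\<in>carrier AG. z \<otimes>\<^bsub>AG\<^esub> f = \<one>\<^bsub>AG\<^esub>"
proof -
  let ?H = "G\<lparr>carrier := H\<rparr>"
  interpret HG: subgroup H G by (rule H)
  interpret H: ring_and_group A ?H
    using A.ring_axioms HG.subgroup_is_group[OF G.group_axioms] by (simp add: ring_and_group_def)
  have HinG: "x \<in> H \<Longrightarrow> x \<in> carrier G" for x using HG.subset by blast
  have inv_eq: "inv\<^bsub>?H\<^esub> x = inv\<^bsub>G\<^esub> x" if "x \<in> H" for x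
    using G.m_inv_consistent[OF H that] .
  have f0: "f x = \<zero>\<^bsub>A\<^esub>" if "x \<in> carrier G" "x \<notin> H" for x
    using f(2) that by (auto simp: supp_def)
  have rf: "restrict f H \<in> carrier (group_ring A ?H)"
    using f(1) HinG by (intro H.AG_memI[OF _ _ finite_supp[OF f(1)]]) (auto simp: supp_def)
  define S where "S = supp A ?H y"
  have S: "finite S" "S \<subseteq> H" using H.finite_supp[OF y] by (auto simp: S_def supp_def)
  define z where "z = (\<lambda>x\<in>carrier G. if x \<in> H then y x else \<zero>\<^bsub>A\<^esub>)"
  have yc: "x \<in> H \<Longrightarrow> y x \<in> carrier A" for x using H.coeff_closed[OF y] by simp
  have z: "z \<in> carrier AG"
    by (rule AG_memI[OF _ _ S(1)]) (auto simp: z_def yc S_def supp_def)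
  have supp_z: "supp A G z \<subseteq> S" by (auto simp: supp_def z_def S_def split: if_splits)
  have SG: "S \<subseteq> carrier G" using S HinG by blast
  have "(z \<otimes>\<^bsub>AG\<^esub> f) x = \<one>\<^bsub>AG\<^esub> x" if x: "x \<in> carrier G" for x
  proof -
    have zf: "(z \<otimes>\<^bsub>AG\<^esub> f) x = (\<Oplus>\<^bsub>A\<^esub>h\<in>S. z h \<otimes>\<^bsub>A\<^esub> f (inv\<^bsub>G\<^esub> h \<otimes>\<^bsub>G\<^esub> x))"
      by (rule mult_coeff[OF z f(1) x S(1) supp_z SG])
    show ?thesis
    proof (cases "x \<in> H")
      case True
      have "(\<Oplus>\<^bsub>A\<^esub>h\<in>S. z h \<otimes>\<^bsub>A\<^esub> f (inv\<^bsub>G\<^esub> h \<otimes>\<^bsub>G\<^esub> x))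
          = (\<Oplus>\<^bsub>A\<^esub>h\<in>S. y h \<otimes>\<^bsub>A\<^esub> restrict f H (inv\<^bsub>?H\<^esub> h \<otimes>\<^bsub>?H\<^esub> x))"
      proof (rule A.finsum_cong')
        show "(\<lambda>h. y h \<otimes>\<^bsub>A\<^esub> restrict f H (inv\<^bsub>?H\<^esub> h \<otimes>\<^bsub>?H\<^esub> x)) \<in> S \<rightarrow> carrier A"
          using S(2) True yc f(1) HinG by (auto simp: inv_eq subset_iff)
        fix h assume "h \<in> S"
        then have "h \<in> H" using S by blast
        then show "z h \<otimes>\<^bsub>A\<^esub> f (inv\<^bsub>G\<^esub> h \<otimes>\<^bsub>G\<^esub> x) = y h \<otimes>\<^bsub>A\<^esub> restrict f H (inv\<^bsub>?H\<^esub> h \<otimes>\<^bsub>?H\<^esub> x)"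
          using True HinG by (simp add: z_def inv_eq)
      qed simp
      also have "\<dots> = (y \<otimes>\<^bsub>group_ring A ?H\<^esub> restrict f H) x"
        using S True by (intro H.mult_coeff[OF y rf, symmetric]) (auto simp: S_def)
      also have "\<dots> = \<one>\<^bsub>AG\<^esub> x"
        unfolding yf using True x by (simp add: one_eq_single H.one_eq_single)
      finally show ?thesis using zf by simp
    next
      case False
      have "z h \<otimes>\<^bsub>A\<^esub> f (inv\<^bsub>G\<^esub> h \<otimes>\<^bsub>G\<^esub> x) = \<zero>\<^bsub>A\<^esub>" if "h \<in> S" for h
      proof -
        have h: "h \<in> H" "h \<in> carrier G" using that S HinG by auto
        have "inv\<^bsub>G\<^esub> h \<otimes>\<^bsub>G\<^esub> x \<notin> H"
        proof
          assume "inv\<^bsub>G\<^esub> h \<otimes>\<^bsub>G\<^esub> x \<in> H"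
          then have "h \<otimes>\<^bsub>G\<^esub> (inv\<^bsub>G\<^esub> h \<otimes>\<^bsub>G\<^esub> x) \<in> H" using h by blast
          then show False using False h x by (simp add: G.m_assoc[symmetric])
        qed
        then show ?thesis using f0 h x yc by (simp add: z_def)
      qed
      then have "(z \<otimes>\<^bsub>AG\<^esub> f) x = \<zero>\<^bsub>A\<^esub>" unfolding zf by (rule A.add.finprod_one_eqI)
      moreover have "x \<noteq> \<one>\<^bsub>G\<^esub>" using False HG.one_closed by blast
      ultimately show ?thesis using x by (simp add: one_eq_single)
    qed
  qed
  then have "z \<otimes>\<^bsub>AG\<^esub> f = \<one>\<^bsub>AG\<^esub>" using z f(1) by (intro AG_eqI) auto
  then show ?thesis using z by blast
qed

lemma finite_p_group_left_inverse:
  assumes fin: "finite (carrier G)" and p: "Factorial_Ring.prime p" and pG: "p_group p G"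
    and loc: "local_ring A" and M: "maximal_left_ideal M A" "add_pow A (p::nat) \<one>\<^bsub>A\<^esub> \<in> M"
    and f: "f \<in> carrier AG" "aug f \<notin> M"
  shows "\<exists>y\<in>carrier AG. y \<otimes>\<^bsub>AG\<^esub> f = \<one>\<^bsub>AG\<^esub>"
proof -
  have "local_ring AG"
    using aug_vimage_maximal_left_ideal[OF M(1)] finite_p_group_maximal_left_ideal[OF fin p pG loc M]
      AG.ring_axioms unfolding local_ring_def local_ring_axioms_def by blast
  then show ?thesis
    using local_ring_left_inverse[OF _ aug_vimage_maximal_left_ideal[OF M(1)] f(1)] f(2) by simp
qed

text \<open>An element with augmentation outside \<open>M\<close> is left invertible already in the group ring of the finite
  \<open>p\<close>-group generated by its support.\<close>
lemma locally_finite_p_group_local_ring: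
  assumes lf: "locally_finite_group G" and p: "Factorial_Ring.prime p" and pG: "p_group p G"
    and loc: "local_ring A" and M: "maximal_left_ideal M A" "add_pow A (p::nat) \<one>\<^bsub>A\<^esub> \<in> M"
  shows "local_ring AG"
proof -
  interpret M: maximal_left_ideal M A by (rule M)
  have "\<exists>y\<in>carrier AG. y \<otimes>\<^bsub>AG\<^esub> f = \<one>\<^bsub>AG\<^esub>"
    if f: "f \<in> carrier AG" "f \<notin> {f \<in> carrier AG. aug f \<in> M}" for f
  proof -
    define H where "H = generate G (supp A G f)"
    let ?H = "G\<lparr>carrier := H\<rparr>"
    have H: "subgroup H G" unfolding H_def by (rule G.generate_is_subgroup[OF supp_subset])
    have finH: "finite H"
      using lf supp_subset finite_supp[OF f(1)] by (simp add: locally_finite_group_def H_def)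
    have sub: "supp A G f \<subseteq> H" unfolding H_def by (auto intro: generate.incl)
    have HG: "H \<subseteq> carrier G" by (rule subgroup.subset[OF H])
    interpret H: ring_and_group A ?H
      using A.ring_axioms subgroup.subgroup_is_group[OF H G.group_axioms]
      by (simp add: ring_and_group_def)
    have supp_eq: "supp A ?H (restrict f H) = supp A G f"
      using sub HG by (auto simp: supp_def)
    have rf: "restrict f H \<in> carrier (group_ring A ?H)"
      using f(1) HG by (intro H.AG_memI[OF _ _ finH]) auto
    have "H.aug (restrict f H) = (\<Oplus>\<^bsub>A\<^esub>x\<in>supp A G f. restrict f H x)"
      unfolding H.aug_def supp_eq ..
    also have "\<dots> = aug f"
      unfolding aug_def using sub f(1) by (intro A.finsum_cong') (auto simp: supp_def)
    finally have "H.aug (restrict f H) \<notin> M" using f by simp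
    moreover have "finite (carrier ?H)" using finH by simp
    ultimately obtain y where "y \<in> carrier (group_ring A ?H)"
      "y \<otimes>\<^bsub>group_ring A ?H\<^esub> restrict f H = \<one>\<^bsub>group_ring A ?H\<^esub>"
      using H.finite_p_group_left_inverse[OF _ p p_group_subgroup[OF pG H] loc M rf] by blast
    then show ?thesis by (rule left_inverse_from_subgroup[OF H f(1) sub])
  qed
  moreover have "left_ideal {f \<in> carrier AG. aug f \<in> M} AG"
    by (rule aug_vimage_left_ideal[OF M.left_ideal_axioms])
  moreover have "\<one>\<^bsub>AG\<^esub> \<notin> {f \<in> carrier AG. aug f \<in> M}" using M.one_notin by simp
  ultimately show ?thesis using maximal_left_ideal_if_left_inverses by blast
qed

end

theorem theorem1:
  fixes A :: "('a, 'm) ring_scheme" and G :: "('g, 'n) monoid_scheme"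
  assumes "ring A" and "\<one>\<^bsub>A\<^esub> \<noteq> \<zero>\<^bsub>A\<^esub>"
    and "group G" and "carrier G \<noteq> {\<one>\<^bsub>G\<^esub>}"
  shows "(local_ring (group_ring A G) \<longrightarrow>
           local_ring A \<and>
           (\<forall>M. maximal_left_ideal M A \<longrightarrow>
              (\<exists>p::nat. Factorial_Ring.prime p \<and> ring_char (A Quot M) = p \<and> p_group p G)))
       \<and> (\<forall>M. locally_finite_group G \<and> local_ring A \<and> maximal_left_ideal M A \<and>
              (\<exists>p::nat. Factorial_Ring.prime p \<and> ring_char (A Quot M) = p \<and> p_group p G) \<longrightarrow>
            local_ring (group_ring A G))"
proof -
  interpret ring_and_group A G using assms by (simp add: ring_and_group_def)
  show ?thesis
  proof (intro conjI impI allI)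
    assume loc: "local_ring (group_ring A G)"
    show "local_ring A" by (rule local_ring_coefficients[OF loc assms(2)])
    fix M assume M: "maximal_left_ideal M A"
    show "\<exists>p::nat. Factorial_Ring.prime p \<and> ring_char (A Quot M) = p \<and> p_group p G"
      by (rule local_group_ring_imp_p_group[OF loc M assms(4)])
  next
    fix M
    assume *: "locally_finite_group G \<and> local_ring A \<and> maximal_left_ideal M A \<and>
              (\<exists>p::nat. Factorial_Ring.prime p \<and> ring_char (A Quot M) = p \<and> p_group p G)"
    then obtain p :: nat where p: "Factorial_Ring.prime p" "ring_char (A Quot M) = p" "p_group p G"
      by blast
    then have "add_pow A p \<one>\<^bsub>A\<^esub> \<in> M"
      using * maximal_left_ideal.ring_char_Quot_eq_prime_iff by blast
    then show "local_ring (group_ring A G)"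
      using * p locally_finite_p_group_local_ring by blast
  qed
qed

end
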